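(* Let $H\in\,]\frac14,\frac12[$, let $p\in\,]1,4[$ be such that $pH>1$, let $\gamma>0$ and let $\alpha>0$. Then: (a) For every $j=1,2,3$, $$\lim_{m,m'\to\infty}\ \sup_{\|h\|_{\mathcal{H}}\le\alpha}D_{j,p}(h(m),h(m'))=0.$$ (b) For every $j=1,2$, $$\sup_{m\in\mathbb{N}}\ \sup_{\|h\|_{\mathcal{H}}\le\alpha}D_{j,p}(h(m))<\infty.$$
   Context: Reproducing kernel Hilbert space of the $d$-dimensional fractional Brownian motion: for $0<s<t\le1$, $$K(t,s)=c_H(t-s)^{H-\frac12}+c_H\left(\tfrac12-H\right)\int_s^t(u-s)^{H-\frac32}\left(1-\left(\tfrac su\right)^{\frac12-H}\right)du,$$ and $K(t,s)=0$ for $s\ge t$, where $c_H>0$ is the normalizing constant for which $\int_0^1K(t,r)K(s,r)\,dr=\frac12(s^{2H}+t^{2H}-|t-s|^{2H})$. $\mathcal{H}$ is the set of $h:[0,1]\to\mathbb{R}^d$ of the form $h(t)=\int_0^tK(t,s)\dot h(s)\,ds$ with $\dot h\in L^2([0,1];\mathbb{R}^d)$, and $\|h\|_{\mathcal{H}}=\|\dot h\|_{L^2}$. For $h\in\mathcal{H}$ and $m\ge1$, $h(m)$ is the linear interpolation of $h$ on the dyadic grid $t^m_l=l2^{-m}$, $0\le l\le2^m$, and for $0\le s\le t\le1$, $j=1,2,3$, $$h(m)^j_{s,t}=\int\cdots\int_{s<t_1<\cdots<t_j<t}dh(m)_{t_1}\otimes\cdots\otimes dh(m)_{t_j}\in(\mathbb{R}^d)^{\otimes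 j}.$$ For functions $X=(X^j_{s,t})$, $Y=(Y^j_{s,t})$ with $X^j_{s,t},Y^j_{s,t}\in(\mathbb{R}^d)^{\otimes j}$, $$D_{j,p}(X,Y)=\left(\sum_{n=1}^\infty n^\gamma\sum_{l=1}^{2^n}\left|X^j_{t^n_{l-1},t^n_l}-Y^j_{t^n_{l-1},t^n_l}\right|^{p/j}\right)^{j/p},\qquad D_{j,p}(X)=D_{j,p}(X,0).$$ $D_{j,p}(h(m),h(m'))$ and $D_{j,p}(h(m))$ are computed with the iterated integrals $h(m)^j$ and $h(m')^j$. *)

theory Defs
  imports "HOL-Analysis.Analysis"
begin

text \<open>The parameter \<open>c\<close> stands for the normalizing constant; it is pinned down by
  \<open>fbm_normalizing\<close> below. At \<open>s = 0\<close> the kernel is set to \<open>0\<close>; this null set plays no role.\<close>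

definition fbm_kernel :: "real \<Rightarrow> real \<Rightarrow> real \<Rightarrow> real \<Rightarrow> real" where
  "fbm_kernel H c t s =
    (if 0 < s \<and> s < t
     then c * (t - s) powr (H - 1/2)
        + c * (1/2 - H) *
          (LINT u:{s..t}|lborel. (u - s) powr (H - 3/2) * (1 - (s / u) powr (1/2 - H)))
     else 0)"

text \<open>For \<open>0 < H < 1/2\<close> exactly one \<open>c\<close> satisfies the following, namely
  \<open>sqrt (2 * H * Gamma (3/2 - H) / (Gamma (H + 1/2) * Gamma (2 - 2 * H)))\<close>.\<close>

definition fbm_normalizing :: "real \<Rightarrow> real \<Rightarrow> bool" where
  "fbm_normalizing H c \<longleftrightarrow> c > 0 \<and>
    (\<forall>s\<in>{0..1}. \<forall>t\<in>{0..1}.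
      (LINT r:{0..1}|lborel. fbm_kernel H c t r * fbm_kernel H c s r) =
        (s powr (2 * H) + t powr (2 * H) - \<bar>t - s\<bar> powr (2 * H)) / 2)"

definition L2_01 :: "(real \<Rightarrow> real ^ 'd) set" where
  "L2_01 = {g. set_borel_measurable lborel {0..1} g \<and>
               set_integrable lborel {0..1} (\<lambda>s. (norm (g s))\<^sup>2)}"

definition L2_01_norm :: "(real \<Rightarrow> real ^ 'd) \<Rightarrow> real" where
  "L2_01_norm g = sqrt (LINT s:{0..1}|lborel. (norm (g s))\<^sup>2)"

definition fbm_density :: "real \<Rightarrow> real \<Rightarrow> (real \<Rightarrow> real ^ 'd) \<Rightarrow> (real \<Rightarrow> real ^ 'd) \<Rightarrow> bool" where
  "fbm_density H c h g \<longleftrightarrow> g \<in> L2_01 \<and>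
    (\<forall>t\<in>{0..1}. h t = (LINT s:{0..t}|lborel. fbm_kernel H c t s *\<^sub>R g s))"

text \<open>A path on \<open>[0,1]\<close> is a function on \<open>real\<close> of which only the values on \<open>{0..1}\<close> matter.\<close>

definition fbm_rkhs :: "real \<Rightarrow> real \<Rightarrow> (real \<Rightarrow> real ^ 'd) set" where
  "fbm_rkhs H c = {h. \<exists>g. fbm_density H c h g}"

text \<open>The density of \<open>h\<close> is unique up to null sets, so the choice does not affect the norm.\<close>

definition fbm_rkhs_norm :: "real \<Rightarrow> real \<Rightarrow> (real \<Rightarrow> real ^ 'd) \<Rightarrow> real" where
  "fbm_rkhs_norm H c h = L2_01_norm (SOME g. fbm_density H c h g)"

definition fbm_rkhs_ball :: "real \<Rightarrow> real \<Rightarrow> real \<Rightarrow> (real \<Rightarrow> real ^ 'd) set" where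
  "fbm_rkhs_ball H c \<alpha> = {h \<in> fbm_rkhs H c. fbm_rkhs_norm H c h \<le> \<alpha>}"

definition dyadic_interp :: "nat \<Rightarrow> (real \<Rightarrow> real ^ 'd) \<Rightarrow> real \<Rightarrow> real ^ 'd" where
  "dyadic_interp m h t =
    (let l = of_int \<lfloor>2 ^ m * t\<rfloor> in
       h (l / 2 ^ m) + (2 ^ m * t - l) *\<^sub>R (h ((l + 1) / 2 ^ m) - h (l / 2 ^ m)))"

text \<open>An element of the \<open>j\<close>-fold tensor power of \<open>real ^ 'd\<close> is given by its coordinates, indexed by
  the words of length \<open>j\<close> over \<open>'d\<close>: the word \<open>[i1, \<dots>, ij]\<close> carries the coefficient of the tensor
  product of the basis vectors \<open>e i1, \<dots>, e ij\<close>. A function on all words thus collects tensors of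
  all degrees, and its degree-\<open>j\<close> component is its restriction to the words of length \<open>j\<close>.
  Tensors carry the Euclidean norm.\<close>

definition tensor_norm :: "nat \<Rightarrow> ('d::finite list \<Rightarrow> real) \<Rightarrow> real" where
  "tensor_norm j a = sqrt (\<Sum>w | length w = j. (a w)\<^sup>2)"

text \<open>Coordinates of the iterated integrals over \<open>s < t1 < \<dots> < tj < t\<close> of a piecewise continuously
  differentiable path \<open>x\<close>, for which \<open>dx\<close> is \<open>x'(u) du\<close>. The recursion integrates over \<open>t1 = u\<close>
  last, the remaining times ranging over \<open>u < t2 < \<dots> < tj < t\<close>. The points where
  \<open>x\<close> is not differentiable form a null set.\<close>

primrec iterated_integral :: "(real \<Rightarrow> real ^ 'd) \<Rightarrow> real \<Rightarrow> real \<Rightarrow> 'd list \<Rightarrow> real" where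
  "iterated_integral x s t [] = 1"
| "iterated_integral x s t (i # w) =
    (LINT u:{s..t}|lborel. vector_derivative x (at u) $ i * iterated_integral x u t w)"

text \<open>Real powers of extended nonnegative numbers, for positive exponents \<open>a\<close>.\<close>

definition ennreal_rpow :: "ennreal \<Rightarrow> real \<Rightarrow> ennreal" where
  "ennreal_rpow x a = (if x = \<infinity> then \<infinity> else ennreal (enn2real x powr a))"

text \<open>The series over \<open>n \<ge> 1\<close> is indexed by \<open>k = n - 1\<close>; it may diverge, hence the values in
  \<open>ennreal\<close>.\<close>

definition rough_dist :: "real \<Rightarrow> nat \<Rightarrow> real \<Rightarrow> (real \<Rightarrow> real \<Rightarrow> 'd::finite list \<Rightarrow> real) \<Rightarrow>
    (real \<Rightarrow> real \<Rightarrow> 'd list \<Rightarrow> real) \<Rightarrow> ennreal" where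
  "rough_dist \<gamma> j p X Y =
    ennreal_rpow
      (\<Sum>k. let n = Suc k in
        ennreal (real n powr \<gamma> *
          (\<Sum>l = 1..2 ^ n.
             tensor_norm j (\<lambda>w. X (real (l - 1) / 2 ^ n) (real l / 2 ^ n) w
                              - Y (real (l - 1) / 2 ^ n) (real l / 2 ^ n) w) powr (p / real j))))
      (real j / p)"

definition rough_size :: "real \<Rightarrow> nat \<Rightarrow> real \<Rightarrow> (real \<Rightarrow> real \<Rightarrow> 'd::finite list \<Rightarrow> real) \<Rightarrow> ennreal" where
  "rough_size \<gamma> j p X = rough_dist \<gamma> j p X (\<lambda>s t w. 0)"

end

theory Submission
  imports Defs "HOL-Real_Asymp.Real_Asymp"
begin

text \<open>Write \<open>\<Delta> n l\<close> for the increment of \<open>h\<close> over the \<open>l\<close>-th dyadic interval of level \<open>n\<close>. It is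
  the inner product of the density of \<open>h\<close> with a difference of kernels, and the Gram matrix of these
  differences is the covariance matrix of fractional Brownian increments. For \<open>H < 1/2\<close> distinct
  increments are negatively correlated, so its row sums of absolute values are at most
  \<open>2 * 2 powr (- 2 * H * n)\<close>. Hence \<open>\<Sum>l. \<bar>\<Delta> n l\<bar>\<^sup>2 \<le> 2 * \<alpha>\<^sup>2 * 2 powr (- 2 * H * n)\<close> on the ball of radius
  \<open>\<alpha>\<close>; this energy estimate replaces a variation embedding and Young integration.

  On a dyadic interval of level \<open>m\<close>, the paths \<open>h(m)\<close> and \<open>h(m + 1)\<close> have the same increment and
  their second iterated integrals differ by a Levy area, which the energy of level \<open>m + 1\<close>
  controls. Chen's identity carries this to level \<open>n \<le> m\<close> without loss in the sum over all intervals,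
  also for the third iterated integrals. With \<open>\<theta> = 2 powr (- H)\<close> the \<open>j\<close>-th iterated integrals over an interval of level
  \<open>n\<close> are therefore \<open>O(\<theta> ^ (j * n))\<close>, and those of \<open>h(m)\<close> and \<open>h(m')\<close> differ by
  \<open>O(\<theta> ^ (2 * (min m m' - n)) * \<theta> ^ (j * n))\<close> if \<open>n \<le> min m m'\<close>. The level-\<open>n\<close> term of the series is thus
  dominated by \<open>n powr \<gamma> * 2 powr (n * (1 - p * H))\<close>, which is summable, and Tannery's theorem applies.\<close>

subsection \<open>The energy of dyadic increments\<close>

text \<open>Concavity of the power \<open>a\<close>, obtained from convexity of its inverse, the
  power \<open>1/a\<close>, at the midpoint of \<open>P\<close> and \<open>Q\<close>. If
  \<open>d = h\<close>, one of the points is 0 and the claim follows from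
  \<open>2 powr a \<le> 2\<close>.\<close>

lemma powr_second_difference_nonpos:
  fixes a d h :: real
  assumes "0 < a" "a \<le> 1" "h \<ge> 0" "d \<ge> h"
  shows "(d + h) powr a + (d - h) powr a \<le> 2 * d powr a"
proof (cases "d = h \<or> h = 0")
  case True
  moreover have "(2 * d) powr a \<le> 2 * d powr a" if "d = h"
  proof -
    have "(2::real) powr a \<le> 2 powr 1" using assms by (intro powr_mono) auto
    then have "2 powr a * d powr a \<le> 2 * d powr a" by (intro mult_right_mono) auto
    then show ?thesis using assms by (simp add: powr_mult)
  qed
  ultimately show ?thesis by auto
next
  case False
  then have d: "d > 0" "d - h > 0" "d + h > 0" using assms by auto
  define P where "P = (d + h) powr a"
  define Q where "Q = (d - h) powr a"
  have PQ: "P > 0" "Q > 0" "P powr (1/a) = d + h" "Q powr (1/a) = d - h"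
    using d assms by (auto simp: P_def Q_def powr_powr)
  have "((1 - 1/2) *\<^sub>R P + (1/2) *\<^sub>R Q) powr (1/a) \<le> (1 - 1/2) * P powr (1/a) + 1/2 * Q powr (1/a)"
    using PQ assms by (intro convex_onD[OF powr_convex]) auto
  then have "((P + Q) / 2) powr (1/a) \<le> d" using PQ by (simp add: field_simps)
  then have "(((P + Q) / 2) powr (1/a)) powr a \<le> d powr a"
    using assms by (intro powr_mono2) auto
  then show ?thesis using PQ assms by (simp add: powr_powr P_def Q_def)
qed

text \<open>Schur's test: split each product by \<open>2 * \<bar>x r * x s\<bar> \<le> (x r)\<^sup>2
  + (x s)\<^sup>2\<close>; symmetry turns the resulting column sums into row sums.\<close>

lemma gram_bound:
  fixes x :: "nat \<Rightarrow> real" and G :: "nat \<Rightarrow> nat \<Rightarrow> real"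
  assumes sym: "\<And>r s. r < N \<Longrightarrow> s < N \<Longrightarrow> G r s = G s r"
    and row: "\<And>r. r < N \<Longrightarrow> (\<Sum>s<N. \<bar>G r s\<bar>) \<le> M"
  shows "(\<Sum>r<N. \<Sum>s<N. x r * x s * G r s) \<le> M * (\<Sum>r<N. (x r)\<^sup>2)"
proof -
  have "(\<Sum>r<N. \<Sum>s<N. x r * x s * G r s)
      \<le> (\<Sum>r<N. \<Sum>s<N. (x r)\<^sup>2 * \<bar>G r s\<bar> / 2 + (x s)\<^sup>2 * \<bar>G r s\<bar> / 2)"
  proof (intro sum_mono)
    fix r s
    have "x r * x s * G r s \<le> \<bar>x r * x s\<bar> * \<bar>G r s\<bar>"
      by (metis abs_ge_self abs_mult)
    also have "\<dots> \<le> (((x r)\<^sup>2 + (x s)\<^sup>2) / 2) * \<bar>G r s\<bar>"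
      using sum_squares_bound[of "\<bar>x r\<bar>" "\<bar>x s\<bar>"] by (intro mult_right_mono) (auto simp: abs_mult)
    finally show "x r * x s * G r s \<le> (x r)\<^sup>2 * \<bar>G r s\<bar> / 2 + (x s)\<^sup>2 * \<bar>G r s\<bar> / 2"
      by (simp add: field_simps)
  qed
  also have "\<dots> = (\<Sum>r<N. \<Sum>s<N. (x r)\<^sup>2 * \<bar>G r s\<bar> / 2) + (\<Sum>r<N. \<Sum>s<N. (x s)\<^sup>2 * \<bar>G r s\<bar> / 2)"
    by (simp add: sum.distrib)
  also have "(\<Sum>r<N. \<Sum>s<N. (x s)\<^sup>2 * \<bar>G r s\<bar> / 2) = (\<Sum>r<N. \<Sum>s<N. (x r)\<^sup>2 * \<bar>G r s\<bar> / 2)"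
    by (subst sum.swap) (auto intro!: sum.cong simp: sym)
  also have "(\<Sum>r<N. \<Sum>s<N. (x r)\<^sup>2 * \<bar>G r s\<bar> / 2) + (\<Sum>r<N. \<Sum>s<N. (x r)\<^sup>2 * \<bar>G r s\<bar> / 2)
      = (\<Sum>r<N. (x r)\<^sup>2 * (\<Sum>s<N. \<bar>G r s\<bar>))"
    by (simp add: sum_distrib_left sum_divide_distrib[symmetric])
  also have "\<dots> \<le> (\<Sum>r<N. (x r)\<^sup>2 * M)"
    by (intro sum_mono mult_left_mono row) auto
  finally show ?thesis by (simp add: sum_distrib_left mult.commute)
qed

text \<open>Expand \<open>0 \<le> \<integral> (M f - \<Sum>r. \<langle>f, \<phi> r\<rangle> \<phi> r)\<^sup>2\<close>.\<close>
lemma bessel_gram: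
  fixes f :: "real \<Rightarrow> real" and \<phi> :: "nat \<Rightarrow> real \<Rightarrow> real"
  assumes ff: "integrable L (\<lambda>u. f u * f u)"
    and fp: "\<And>r. r < N \<Longrightarrow> integrable L (\<lambda>u. f u * \<phi> r u)"
    and pp: "\<And>r s. r < N \<Longrightarrow> s < N \<Longrightarrow> integrable L (\<lambda>u. \<phi> r u * \<phi> s u)"
    and row: "\<And>r. r < N \<Longrightarrow> (\<Sum>s<N. \<bar>LINT u|L. \<phi> r u * \<phi> s u\<bar>) \<le> M" and M: "M > 0"
  shows "(\<Sum>r<N. (LINT u|L. f u * \<phi> r u)\<^sup>2) \<le> M * (LINT u|L. f u * f u)"
proof -
  define x where "x r = (LINT u|L. f u * \<phi> r u)" for r
  define S where "S = (\<Sum>r<N. (x r)\<^sup>2)"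
  define Q where "Q = (LINT u|L. (\<Sum>r<N. x r * \<phi> r u) * (\<Sum>r<N. x r * \<phi> r u))"
  have eq: "(\<Sum>r<N. x r * \<phi> r u) * (\<Sum>r<N. x r * \<phi> r u)
      = (\<Sum>r<N. \<Sum>s<N. x r * x s * (\<phi> r u * \<phi> s u))" for u
    by (simp add: sum_product mult_ac)
  have eq2: "f u * (\<Sum>r<N. x r * \<phi> r u) = (\<Sum>r<N. x r * (f u * \<phi> r u))" for u
    by (simp add: sum_distrib_left mult_ac)
  have i1: "integrable L (\<lambda>u. (\<Sum>r<N. x r * \<phi> r u) * (\<Sum>r<N. x r * \<phi> r u))"
    unfolding eq by (auto intro!: Bochner_Integration.integrable_sum pp)
  have i2: "integrable L (\<lambda>u. f u * (\<Sum>r<N. x r * \<phi> r u))"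
    unfolding eq2 by (auto intro!: Bochner_Integration.integrable_sum fp)
  have "Q = (\<Sum>r<N. \<Sum>s<N. x r * x s * (LINT u|L. \<phi> r u * \<phi> s u))"
    unfolding Q_def eq
    by (subst Bochner_Integration.integral_sum
        | auto intro!: Bochner_Integration.integrable_sum pp sum.cong)+
  also have "\<dots> \<le> M * S"
    unfolding S_def by (intro gram_bound row) (auto simp: mult.commute)
  finally have Q: "Q \<le> M * S" .
  have SS: "(LINT u|L. f u * (\<Sum>r<N. x r * \<phi> r u)) = S"
    unfolding eq2 S_def
    by (subst Bochner_Integration.integral_sum)
       (auto intro!: fp sum.cong simp: x_def power2_eq_square)
  have "0 \<le> (LINT u|L. (M * f u - (\<Sum>r<N. x r * \<phi> r u))\<^sup>2)" by simp
  also have "(\<lambda>u. (M * f u - (\<Sum>r<N. x r * \<phi> r u))\<^sup>2) =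
      (\<lambda>u. M\<^sup>2 * (f u * f u) - 2 * M * (f u * (\<Sum>r<N. x r * \<phi> r u))
        + (\<Sum>r<N. x r * \<phi> r u) * (\<Sum>r<N. x r * \<phi> r u))"
    by (auto simp: power2_eq_square algebra_simps)
  also have "(LINT u|L. \<dots> u) = M\<^sup>2 * (LINT u|L. f u * f u) - 2 * M * S + Q"
    using i1 i2 ff by (simp add: SS Q_def)
  also have "\<dots> \<le> M * (M * (LINT u|L. f u * f u) - S)"
    using Q by (simp add: power2_eq_square algebra_simps)
  finally have "0 \<le> M * (LINT u|L. f u * f u) - S" using M by (simp add: zero_le_mult_iff)
  then show ?thesis by (simp add: S_def x_def)
qed

definition fbm_cov :: "real \<Rightarrow> real \<Rightarrow> real \<Rightarrow> real" where
  "fbm_cov H s t = (s powr (2 * H) + t powr (2 * H) - \<bar>t - s\<bar> powr (2 * H)) / 2"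

text \<open>The sign allows measurability of the kernel to be recovered from that of its square. In
  the integrand \<open>s / u \<le> 1\<close> is raised to a positive power.\<close>

lemma fbm_kernel_nonneg:
  assumes "0 < H" "H < 1/2" "c > 0"
  shows "fbm_kernel H c t s \<ge> 0"
proof (cases "0 < s \<and> s < t")
  case True
  have "(LINT u:{s..t}|lborel. (u - s) powr (H - 3/2) * (1 - (s / u) powr (1/2 - H))) \<ge> 0"
    unfolding set_lebesgue_integral_def
  proof (intro integral_nonneg_AE AE_I2)
    fix u
    show "0 \<le> indicat_real {s..t} u *\<^sub>R ((u - s) powr (H - 3/2) * (1 - (s / u) powr (1/2 - H)))"
    proof (cases "u \<in> {s..t}")
      case u: True
      have "(s / u) powr (1/2 - H) \<le> 1 powr (1/2 - H)"
        using True u assms by (intro powr_mono2) auto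
      then show ?thesis using u by simp
    qed simp
  qed
  then show ?thesis using assms True unfolding fbm_kernel_def by auto
qed (auto simp: fbm_kernel_def)

text \<open>The Bochner integral of a non-integrable function is 0, whereas the normalization at
  \<open>s = t\<close> gives the value \<open>t powr (2 * H)\<close>, which is nonzero for
  \<open>t > 0\<close>.\<close>

lemma fbm_kernel_square_integrable:
  assumes "0 < H" "H < 1/2" "fbm_normalizing H c" "t \<in> {0..1}"
  shows "set_integrable lborel {0..1} (\<lambda>r. fbm_kernel H c t r * fbm_kernel H c t r)"
proof (cases "t = 0")
  case True
  then have "fbm_kernel H c t r = 0" for r by (simp add: fbm_kernel_def)
  then show ?thesis by (simp add: set_integrable_def)
next
  case False
  have "(LINT r:{0..1}|lborel. fbm_kernel H c t r * fbm_kernel H c t r) 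
      = (t powr (2 * H) + t powr (2 * H) - \<bar>t - t\<bar> powr (2 * H)) / 2"
    using assms unfolding fbm_normalizing_def by blast
  also have "\<dots> = t powr (2 * H)" using assms by simp
  also have "\<dots> \<noteq> 0" using False by simp
  finally show ?thesis
    unfolding set_integrable_def set_lebesgue_integral_def
    using not_integrable_integral_eq by blast
qed

lemma set_integrable_nonneg_square_imp_measurable:
  fixes f :: "'a \<Rightarrow> real"
  assumes "set_integrable M A (\<lambda>r. f r * f r)" "\<And>r. f r \<ge> 0"
  shows "(\<lambda>r. indicator A r * f r) \<in> borel_measurable M"
proof -
  have "(\<lambda>r. sqrt (indicator A r *\<^sub>R (f r * f r))) \<in> borel_measurable M"
    using assms(1) unfolding set_integrable_def by measurable
  also have "(\<lambda>r. sqrt (indicator A r *\<^sub>R (f r * f r))) = (\<lambda>r. indicator A r * f r)"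
    using assms(2) by (auto simp: indicator_def real_sqrt_mult)
  finally show ?thesis .
qed

lemma integrable_mult_square:
  fixes f g :: "'a \<Rightarrow> real"
  assumes "f \<in> borel_measurable M" "g \<in> borel_measurable M"
    and "integrable M (\<lambda>x. f x * f x)" "integrable M (\<lambda>x. g x * g x)"
  shows "integrable M (\<lambda>x. f x * g x)"
proof (rule Bochner_Integration.integrable_bound[where f = "\<lambda>x. f x * f x + g x * g x"])
  show "AE x in M. norm (f x * g x) \<le> norm (f x * f x + g x * g x)"
  proof (intro AE_I2)
    fix x
    have "2 * \<bar>f x\<bar> * \<bar>g x\<bar> \<le> \<bar>f x\<bar>\<^sup>2 + \<bar>g x\<bar>\<^sup>2" by (rule sum_squares_bound)
    moreover have "0 \<le> \<bar>f x\<bar> * \<bar>g x\<bar>" by simp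
    ultimately have "\<bar>f x\<bar> * \<bar>g x\<bar> \<le> f x * f x + g x * g x"
      unfolding power2_abs power2_eq_square by linarith
    then show "norm (f x * g x) \<le> norm (f x * f x + g x * g x)" by (simp add: abs_mult)
  qed
qed (use assms in auto)

text \<open>\<open>G\<close> is half the second difference with step \<open>h\<close> of the power
  \<open>2 * H\<close> at the distance of the left endpoints. That power is concave, and distance at
  least \<open>h\<close> means that the intervals do not overlap.\<close>

lemma fbm_cov_increments_sign:
  fixes H a b a' b' :: real
  defines "G \<equiv> fbm_cov H b b' - fbm_cov H a b' - fbm_cov H b a' + fbm_cov H a a'"
  assumes H: "0 < H" "2 * H \<le> 1" and "b - a = h" "b' - a' = h" "h \<ge> 0" "\<bar>a' - a\<bar> \<ge> h"
  shows "G \<le> 0"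
proof -
  define d where "d = \<bar>a' - a\<bar>"
  have "G = (\<bar>b' - a\<bar> powr (2*H) + \<bar>a' - b\<bar> powr (2*H) - \<bar>b' - b\<bar> powr (2*H) - \<bar>a' - a\<bar> powr (2*H)) / 2"
    by (simp add: G_def fbm_cov_def field_simps)
  moreover have "b' - b = a' - a" "b' - a = (a' - a) + h" "a' - b = (a' - a) - h"
    using assms by auto
  moreover have "\<bar>(a' - a) + h\<bar> powr (2*H) + \<bar>(a' - a) - h\<bar> powr (2*H) = (d + h) powr (2*H) + (d - h) powr (2*H)"
  proof (cases "a' \<ge> a")
    case True
    then show ?thesis using assms by (simp add: d_def)
  next
    case False
    then have "\<bar>(a' - a) + h\<bar> = d - h" "\<bar>(a' - a) - h\<bar> = d + h" using assms by (auto simp: d_def)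
    then show ?thesis by simp
  qed
  moreover have "(d + h) powr (2*H) + (d - h) powr (2*H) \<le> 2 * d powr (2*H)"
    using assms by (intro powr_second_difference_nonpos) (auto simp: d_def)
  ultimately show ?thesis by (simp add: d_def)
qed

text \<open>Disjoint increments are negatively correlated, so the row sum of absolute values is
  \<open>2 G r r - \<Sum>s. G r s\<close>, and \<open>\<Sum>s. G r s\<close> is the covariance of an increment with the endpoint.\<close>
lemma fbm_cov_row_sum:
  fixes H :: real and N :: nat
  defines "t \<equiv> (\<lambda>r::nat. real r / real N)"
  defines "G \<equiv> (\<lambda>r s. fbm_cov H (t (Suc r)) (t (Suc s)) - fbm_cov H (t r) (t (Suc s))
                - fbm_cov H (t (Suc r)) (t s) + fbm_cov H (t r) (t s))"
  assumes H: "0 < H" "2 * H \<le> 1" and r: "r < N"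
  shows "(\<Sum>s<N. \<bar>G r s\<bar>) \<le> 2 * (1 / real N) powr (2 * H)"
proof -
  have N: "real N > 0" using r by simp
  have diag: "G r r = (1 / real N) powr (2 * H)"
  proof -
    have "t (Suc r) - t r = 1 / real N" using N by (simp add: t_def field_simps)
    moreover have "t r \<le> t (Suc r)" using N by (simp add: t_def field_simps)
    ultimately show ?thesis by (simp add: G_def fbm_cov_def field_simps abs_minus_commute)
  qed
  have off: "G r s \<le> 0" if "s \<noteq> r" for s
    unfolding G_def
  proof (rule fbm_cov_increments_sign[OF H])
    show "t (Suc r) - t r = 1 / real N" "t (Suc s) - t s = 1 / real N" "1 / real N \<ge> 0"
      using N by (auto simp: t_def field_simps)
    have "\<bar>real s - real r\<bar> \<ge> 1" using that by linarith
    then have "\<bar>real s - real r\<bar> / real N \<ge> 1 / real N" using N by (simp add: divide_right_mono)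
    then show "\<bar>t s - t r\<bar> \<ge> 1 / real N" using N by (simp add: t_def flip: diff_divide_distrib)
  qed
  define F where "F s = fbm_cov H (t (Suc r)) (t s) - fbm_cov H (t r) (t s)" for s
  have "(\<Sum>s<N. G r s) = (\<Sum>s<N. F (Suc s) - F s)"
    by (intro sum.cong) (auto simp: G_def F_def)
  also have "\<dots> = F N - F 0" by (rule sum_lessThan_telescope)
  also have "F 0 = 0" using N by (simp add: F_def fbm_cov_def t_def)
  \<comment> \<open>Passing from \<open>t r\<close> to \<open>t (Suc r)\<close> increases the
    point's own power and decreases its distance to \<open>t N\<close>; both raise the covariance
    with \<open>t N\<close>.\<close>
  also have "F N - 0 \<ge> 0"
  proof -
    have "t r powr (2*H) \<le> t (Suc r) powr (2*H)"
      using N H by (intro powr_mono2) (auto simp: t_def field_simps)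
    moreover have "\<bar>t N - t (Suc r)\<bar> powr (2*H) \<le> \<bar>t N - t r\<bar> powr (2*H)"
    proof (intro powr_mono2)
      have "t r \<le> t (Suc r)" "t (Suc r) \<le> t N" using N r by (auto simp: t_def field_simps)
      then show "\<bar>t N - t (Suc r)\<bar> \<le> \<bar>t N - t r\<bar>" by auto
    qed (use H in auto)
    ultimately show ?thesis by (simp add: F_def fbm_cov_def)
  qed
  finally have "(\<Sum>s<N. G r s) \<ge> 0" .
  moreover have "(\<Sum>s<N. \<bar>G r s\<bar>) = (\<Sum>s<N. (if s = r then 2 * G r r else 0) - G r s)"
    using off diag by (intro sum.cong) (auto simp: abs_if le_less)
  moreover have "\<dots> = 2 * G r r - (\<Sum>s<N. G r s)"
    using r by (simp add: sum_subtractf)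
  ultimately show ?thesis using diag by simp
qed

text \<open>\<open>bessel_gram\<close> with \<open>f\<close> a coordinate of the density and
  \<open>\<phi> r\<close> the kernel differences. The normalization identifies their Gram matrix,
  and \<open>fbm_cov_row_sum\<close> supplies \<open>M\<close>.\<close>

lemma fbm_density_increments:
  fixes h :: "real \<Rightarrow> real ^ 'd::finite" and N :: nat
  assumes H: "0 < H" "H < 1/2" and c: "fbm_normalizing H c" and N: "N > 0"
    and g: "fbm_density H c h g"
  shows "(\<Sum>r<N. (h (real (Suc r) / real N) $ i - h (real r / real N) $ i)\<^sup>2)
      \<le> 2 * (1 / real N) powr (2 * H) * (L2_01_norm g)\<^sup>2"
proof -
  define k where "k t u = indicat_real {0..1} u * fbm_kernel H c t u" for t u
  define f where "f u = indicat_real {0..1} u * (g u $ i)" for u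
  define t where "t r = real r / real N" for r
  define \<phi> where "\<phi> r u = k (t (Suc r)) u - k (t r) u" for r u
  have c0: "c > 0" using c by (simp add: fbm_normalizing_def)
  have t01: "t r \<in> {0..1}" if "r \<le> N" for r
    using that N by (auto simp: t_def)
  have kk1: "integrable lborel (\<lambda>u. k s u * k s u)" if "s \<in> {0..1}" for s
  proof -
    have "k s u * k s u = indicat_real {0..1} u *\<^sub>R (fbm_kernel H c s u * fbm_kernel H c s u)" for u
      by (simp add: k_def indicator_def)
    then show ?thesis
      using fbm_kernel_square_integrable[OF H c that] unfolding set_integrable_def by simp
  qed
  have km: "k s \<in> borel_measurable lborel" if "s \<in> {0..1}" for s
    unfolding k_def using fbm_kernel_square_integrable[OF H c that] fbm_kernel_nonneg[OF H c0]
    by (rule set_integrable_nonneg_square_imp_measurable)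
  have kk: "integrable lborel (\<lambda>u. k s u * k s' u)" if "s \<in> {0..1}" "s' \<in> {0..1}" for s s'
    using that by (intro integrable_mult_square[OF km km kk1 kk1])
  have kint: "(LINT u|lborel. k s u * k s' u) = fbm_cov H s' s" if "s \<in> {0..1}" "s' \<in> {0..1}" for s s'
  proof -
    have "(LINT u|lborel. k s u * k s' u) = (LINT r:{0..1}|lborel. fbm_kernel H c s r * fbm_kernel H c s' r)"
      unfolding set_lebesgue_integral_def k_def
      by (intro Bochner_Integration.integral_cong) (auto simp: indicator_def)
    then show ?thesis using that c by (simp add: fbm_normalizing_def fbm_cov_def)
  qed
  have gL: "g \<in> L2_01" using g by (simp add: fbm_density_def)
  have gm: "(\<lambda>u. indicat_real {0..1} u *\<^sub>R g u) \<in> borel_measurable lborel"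
    and gi: "integrable lborel (\<lambda>u. indicat_real {0..1} u *\<^sub>R (norm (g u))\<^sup>2)"
    using gL by (auto simp: L2_01_def set_borel_measurable_def set_integrable_def)
  have fm: "f \<in> borel_measurable lborel"
  proof -
    have "(\<lambda>u. (indicat_real {0..1} u *\<^sub>R g u) $ i) \<in> borel_measurable lborel"
      using gm by (rule borel_measurable_continuous_on[rotated]) (intro continuous_intros)
    then show ?thesis by (simp add: f_def[abs_def])
  qed
  have le: "f u * f u \<le> indicat_real {0..1} u *\<^sub>R (norm (g u))\<^sup>2" for u
    using power_mono[OF component_le_norm_cart[of "g u" i] abs_ge_zero, of 2]
    by (simp add: f_def indicator_def power2_eq_square)
  have ff: "integrable lborel (\<lambda>u. f u * f u)"
    using le fm by (intro Bochner_Integration.integrable_bound[OF gi]) (auto intro!: AE_I2)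
  have fk: "integrable lborel (\<lambda>u. f u * k s u)" if "s \<in> {0..1}" for s
    using that by (intro integrable_mult_square[OF fm km ff kk1])
  have hk: "h s $ i = (LINT u|lborel. f u * k s u)" if "s \<in> {0..1}" for s
  proof -
    \<comment> \<open>The kernel vanishes beyond \<open>s\<close>, so all integrals may be taken
      over the same interval \<open>{0..1}\<close>.\<close>
    have eq: "indicat_real {0..s} u *\<^sub>R fbm_kernel H c s u *\<^sub>R g u
        = k s u *\<^sub>R (indicat_real {0..1} u *\<^sub>R g u)" for u
      using that by (auto simp: k_def indicator_def fbm_kernel_def)
    \<comment> \<open>Integrability of the vector-valued integrand justifies taking the coordinate
      inside the integral.\<close>
    have int: "integrable lborel (\<lambda>u. k s u *\<^sub>R (indicat_real {0..1} u *\<^sub>R g u))"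
    proof (rule Bochner_Integration.integrable_bound)
      show "integrable lborel (\<lambda>u. k s u * k s u + indicat_real {0..1} u *\<^sub>R (norm (g u))\<^sup>2)"
        by (intro Bochner_Integration.integrable_add kk1 that gi)
      show "(\<lambda>u. k s u *\<^sub>R (indicat_real {0..1} u *\<^sub>R g u)) \<in> borel_measurable lborel"
        by (intro borel_measurable_scaleR km that gm)
      show "AE u in lborel. norm (k s u *\<^sub>R (indicat_real {0..1} u *\<^sub>R g u))
          \<le> norm (k s u * k s u + indicat_real {0..1} u *\<^sub>R (norm (g u))\<^sup>2)"
      proof (intro AE_I2)
        fix u
        have "2 * \<bar>k s u\<bar> * norm (g u) \<le> \<bar>k s u\<bar>\<^sup>2 + (norm (g u))\<^sup>2" by (rule sum_squares_bound)
        moreover have "0 \<le> \<bar>k s u\<bar> * norm (g u)" by simp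
        ultimately have "\<bar>k s u\<bar> * norm (g u) \<le> k s u * k s u + (norm (g u))\<^sup>2"
          unfolding power2_abs power2_eq_square by linarith
        then show "norm (k s u *\<^sub>R (indicat_real {0..1} u *\<^sub>R g u))
          \<le> norm (k s u * k s u + indicat_real {0..1} u *\<^sub>R (norm (g u))\<^sup>2)"
          by (simp add: indicator_def)
      qed
    qed
    have "h s = (LINT u:{0..s}|lborel. fbm_kernel H c s u *\<^sub>R g u)"
      using g that by (simp add: fbm_density_def)
    then have "h s $ i = (LINT u|lborel. k s u *\<^sub>R (indicat_real {0..1} u *\<^sub>R g u)) $ i"
      unfolding set_lebesgue_integral_def eq by simp
    also have "\<dots> = (LINT u|lborel. (k s u *\<^sub>R (indicat_real {0..1} u *\<^sub>R g u)) $ i)"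
      using integral_bounded_linear[OF bounded_linear_vec_nth int] by simp
    finally show ?thesis by (simp add: f_def mult_ac)
  qed
  have L: "(LINT u|lborel. f u * f u) \<le> (L2_01_norm g)\<^sup>2"
  proof -
    have "(LINT u|lborel. f u * f u) \<le> (LINT u|lborel. indicat_real {0..1} u *\<^sub>R (norm (g u))\<^sup>2)"
      by (intro integral_mono ff gi le)
    also have "\<dots> = (L2_01_norm g)\<^sup>2"
      by (simp add: L2_01_norm_def set_lebesgue_integral_def)
    finally show ?thesis .
  qed
  have pint: "(LINT u|lborel. \<phi> r u * \<phi> s u) = fbm_cov H (t (Suc r)) (t (Suc s)) - fbm_cov H (t r) (t (Suc s))
                - fbm_cov H (t (Suc r)) (t s) + fbm_cov H (t r) (t s)"
    and pp: "integrable lborel (\<lambda>u. \<phi> r u * \<phi> s u)" if "r < N" "s < N" for r s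
  proof -
    have T: "t r \<in> {0..1}" "t (Suc r) \<in> {0..1}" "t s \<in> {0..1}" "t (Suc s) \<in> {0..1}"
      using that by (simp_all add: t01 del: atLeastAtMost_iff)
    have eq: "\<phi> r u * \<phi> s u = k (t (Suc r)) u * k (t (Suc s)) u - k (t r) u * k (t (Suc s)) u
        - k (t (Suc r)) u * k (t s) u + k (t r) u * k (t s) u" for u
      by (simp add: \<phi>_def algebra_simps)
    show "integrable lborel (\<lambda>u. \<phi> r u * \<phi> s u)"
      unfolding eq by (intro Bochner_Integration.integrable_add Bochner_Integration.integrable_diff kk T)
    have sym: "fbm_cov H x y = fbm_cov H y x" for x y
      by (simp add: fbm_cov_def abs_minus_commute)
    show "(LINT u|lborel. \<phi> r u * \<phi> s u) = fbm_cov H (t (Suc r)) (t (Suc s)) - fbm_cov H (t r) (t (Suc s))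
                - fbm_cov H (t (Suc r)) (t s) + fbm_cov H (t r) (t s)"
      unfolding eq using T by (simp add: kk kint) (simp add: sym)
  qed
  have fp: "integrable lborel (\<lambda>u. f u * \<phi> r u)"
    and fpi: "(LINT u|lborel. f u * \<phi> r u) = h (t (Suc r)) $ i - h (t r) $ i" if "r < N" for r
    using that fk hk t01 by (auto simp: \<phi>_def right_diff_distrib)
  have "(\<Sum>r<N. (h (t (Suc r)) $ i - h (t r) $ i)\<^sup>2) = (\<Sum>r<N. (LINT u|lborel. f u * \<phi> r u)\<^sup>2)"
    by (simp add: fpi)
  also have "\<dots> \<le> 2 * (1 / real N) powr (2 * H) * (LINT u|lborel. f u * f u)"
  proof (rule bessel_gram[OF ff fp pp])
    fix r assume r: "r < N"
    show "(\<Sum>s<N. \<bar>LINT u|lborel. \<phi> r u * \<phi> s u\<bar>) \<le> 2 * (1 / real N) powr (2 * H)"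
      using fbm_cov_row_sum[of H r N] H r by (simp add: pint t_def)
  qed (use N in auto)
  also have "\<dots> \<le> 2 * (1 / real N) powr (2 * H) * (L2_01_norm g)\<^sup>2"
    using L by (intro mult_left_mono) auto
  finally show ?thesis by (simp add: t_def)
qed

subsection \<open>Iterated integrals and Chen's identity\<close>

lemma set_integrable_mult_continuous:
  fixes f g :: "real \<Rightarrow> real"
  assumes f: "set_integrable lborel {a..b} f" and g: "continuous_on {a..b} g"
  shows "set_integrable lborel {a..b} (\<lambda>u. f u * g u)"
proof -
  have "compact (g ` {a..b})" using g by (intro compact_continuous_image) auto
  then obtain B where B: "\<And>u. u \<in> {a..b} \<Longrightarrow> \<bar>g u\<bar> \<le> B"
    by (fastforce dest!: compact_imp_bounded simp: bounded_iff)
  have gm: "(\<lambda>u. indicat_real {a..b} u * g u) \<in> borel_measurable lborel"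
    using borel_measurable_continuous_on_indicator[OF _ g] by simp
  have fm: "(\<lambda>u. indicat_real {a..b} u * f u) \<in> borel_measurable lborel"
    using f unfolding set_integrable_def by auto
  show ?thesis
  proof (rule set_integrable_bound[where f = "\<lambda>u. f u * B"])
    have "(\<lambda>u. (indicat_real {a..b} u * f u) * (indicat_real {a..b} u * g u)) \<in> borel_measurable lborel"
      using fm gm by (rule borel_measurable_times)
    moreover have "(\<lambda>u. (indicat_real {a..b} u * f u) * (indicat_real {a..b} u * g u))
        = (\<lambda>u. indicat_real {a..b} u *\<^sub>R (f u * g u))" by (auto simp: indicator_def)
    ultimately show "set_borel_measurable lborel {a..b} (\<lambda>u. f u * g u)"
      by (simp add: set_borel_measurable_def)
    show "AE u in lborel. u \<in> {a..b} \<longrightarrow> norm (f u * g u) \<le> norm (f u * B)"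
    proof (intro AE_I2 impI)
      fix u assume "u \<in> {a..b}"
      then have "\<bar>g u\<bar> \<le> \<bar>B\<bar>" using B[of u] by simp
      then show "norm (f u * g u) \<le> norm (f u * B)" by (simp add: abs_mult mult_left_mono)
    qed
  qed (use f in auto)
qed

text \<open>Induction on the word: an integrable derivative times a continuous function is
  integrable, and its integral depends continuously on the lower limit. This makes every integrand
  in Chen's identity integrable.\<close>

lemma iterated_integral_continuous:
  assumes x: "\<And>i. set_integrable lborel {a..b} (\<lambda>u. vector_derivative x (at u) $ i)" and "t \<le> b"
  shows "continuous_on {a..t} (\<lambda>s. iterated_integral x s t w)"
proof (induction w)
  case (Cons i w)
  let ?f = "\<lambda>u. vector_derivative x (at u) $ i * iterated_integral x u t w"
  have int: "set_integrable lborel {a..t} ?f"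
    using assms by (intro set_integrable_mult_continuous Cons.IH set_integrable_subset[OF x]) auto
  have "iterated_integral x s t (i # w) = integral {s..t} ?f" if "s \<in> {a..t}" for s
    using that unfolding iterated_integral.simps
    by (intro set_borel_integral_eq_integral(2) set_integrable_subset[OF int]) auto
  then show ?case
    using indefinite_integral_continuous_1'[OF set_borel_integral_eq_integral(1)[OF int]]
    by (subst continuous_on_cong[OF refl]) auto
qed simp

lemma iterated_integral_integrable:
  assumes x: "\<And>i. set_integrable lborel {a..b} (\<lambda>u. vector_derivative x (at u) $ i)" and "t \<le> b"
  shows "set_integrable lborel {a..t} (\<lambda>u. vector_derivative x (at u) $ i * iterated_integral x u t w)"
  using assms
  by (intro set_integrable_mult_continuous iterated_integral_continuous[OF x] set_integrable_subset[OF x]) auto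

lemma set_integral_split:
  fixes f :: "real \<Rightarrow> real"
  assumes f: "set_integrable lborel {s..t} f" and "s \<le> u" "u \<le> t"
  shows "(LINT v:{s..t}|lborel. f v) = (LINT v:{s..u}|lborel. f v) + (LINT v:{u..t}|lborel. f v)"
proof -
  have "{s..t} = {s..u} \<union> {u..t}" using assms by auto
  moreover have "AE v in lborel. \<not> (v \<in> {s..u} \<and> v \<in> {u..t})"
    using AE_lborel_singleton[of u] by eventually_elim auto
  ultimately show ?thesis
    using assms by (simp add: set_integral_Un_AE set_integrable_subset[OF f])
qed

text \<open>Split the integral over the first time \<open>v\<close> at \<open>u\<close>. The part
  \<open>v \<ge> u\<close> is the term \<open>k = 0\<close>; for \<open>v \<le> u\<close> the
  induction hypothesis on \<open>{v..t}\<close> expands the inner integral and yields the terms with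
  \<open>k \<ge> 1\<close>, hence the generalization over \<open>s\<close>.\<close>

theorem chen_identity:
  assumes x: "\<And>i. set_integrable lborel {a..b} (\<lambda>u. vector_derivative x (at u) $ i)"
    and "a \<le> s" "s \<le> u" "u \<le> t" "t \<le> b"
  shows "iterated_integral x s t w =
    (\<Sum>k\<le>length w. iterated_integral x s u (take k w) * iterated_integral x u t (drop k w))"
  using assms(2,3)
proof (induction w arbitrary: s)
  case (Cons i w)
  let ?d = "\<lambda>v. vector_derivative x (at v) $ i"
  note int = iterated_integral_integrable[OF x]
  have "iterated_integral x s t (i # w)
      = (LINT v:{s..u}|lborel. ?d v * iterated_integral x v t w) + iterated_integral x u t (i # w)"
    using Cons.prems assms unfolding iterated_integral.simps
    by (intro set_integral_split set_integrable_subset[OF int[of t]]) auto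
  also have "(LINT v:{s..u}|lborel. ?d v * iterated_integral x v t w)
      = (LINT v:{s..u}|lborel. \<Sum>k\<le>length w. (?d v * iterated_integral x v u (take k w)) * iterated_integral x u t (drop k w))"
    using Cons.prems
    by (intro set_lebesgue_integral_cong) (auto simp: Cons.IH sum_distrib_left mult.assoc)
  also have "\<dots> = (\<Sum>k\<le>length w. LINT v:{s..u}|lborel. (?d v * iterated_integral x v u (take k w)) * iterated_integral x u t (drop k w))"
    unfolding set_lebesgue_integral_def scaleR_sum_right
  proof (intro Bochner_Integration.integral_sum)
    fix k
    have "set_integrable lborel {s..u} (\<lambda>v. ?d v * iterated_integral x v u (take k w))"
      using assms Cons.prems by (intro set_integrable_subset[OF int[of u]]) auto
    then have "set_integrable lborel {s..u} (\<lambda>v. (?d v * iterated_integral x v u (take k w)) * iterated_integral x u t (drop k w))"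
      by simp
    then show "integrable lborel (\<lambda>v. indicat_real {s..u} v *\<^sub>R (?d v * iterated_integral x v u (take k w) * iterated_integral x u t (drop k w)))"
      by (simp only: set_integrable_def)
  qed
  also have "\<dots> = (\<Sum>k\<le>length w. iterated_integral x s u (i # take k w) * iterated_integral x u t (drop k w))"
    by simp
  finally show ?case
    by (simp add: sum.atMost_Suc_shift del: sum.atMost_Suc)
qed simp

text \<open>At constant velocity the iterated integral is the product of the coordinates of
  \<open>v\<close> times the volume of the simplex of ordered times.\<close>

lemma iterated_integral_linear:
  assumes d: "\<And>u. s < u \<Longrightarrow> u < t \<Longrightarrow> vector_derivative x (at u) = v" and "s \<le> t"
  shows "iterated_integral x s t w = (\<Prod>i\<leftarrow>w. v $ i) * (t - s) ^ length w / fact (length w)"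
  using assms
proof (induction w arbitrary: s)
  case (Cons i w)
  let ?n = "length w"
  let ?P = "\<Prod>i\<leftarrow>w. v $ i"
  \<comment> \<open>The derivative is known only on the open interval: the endpoints, a null set,
    are removed to substitute it and then restored for the fundamental theorem of calculus.\<close>
  have "iterated_integral x s t (i # w) = (LINT u:{s<..<t}|lborel. vector_derivative x (at u) $ i * iterated_integral x u t w)"
    unfolding iterated_integral.simps by (rule set_integral_discrete_difference[where X = "{s,t}"]) auto
  also have "\<dots> = (LINT u:{s<..<t}|lborel. v $ i * (?P * (t - u) ^ ?n / fact ?n))"
    using Cons by (intro set_lebesgue_integral_cong) auto
  also have "\<dots> = (LINT u:{s..t}|lborel. v $ i * (?P * (t - u) ^ ?n / fact ?n))"
    by (rule set_integral_discrete_difference[where X = "{s,t}"]) auto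
  also have "\<dots> = v $ i * ?P * (t - s) ^ Suc ?n / fact (Suc ?n)"
  proof -
    let ?F = "\<lambda>u. - (v $ i * ?P * (t - u) ^ Suc ?n / fact (Suc ?n))"
    have "(LINT u:{s..t}|lborel. v $ i * (?P * (t - u) ^ ?n / fact ?n)) = ?F t - ?F s"
      unfolding set_lebesgue_integral_def
    proof (intro integral_FTC_atLeastAtMost)
      fix u
      have "((\<lambda>u. (t - u) ^ Suc ?n) has_real_derivative - (real (Suc ?n) * (t - u) ^ ?n)) (at u within {s..t})"
        by (rule derivative_eq_intros refl | simp)+
      then have "(?F has_real_derivative - (v $ i * ?P * (- (real (Suc ?n) * (t - u) ^ ?n)) / fact (Suc ?n))) (at u within {s..t})"
        by (intro DERIV_minus DERIV_cdivide DERIV_cmult)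
      moreover have "- (v $ i * ?P * (- (real (Suc ?n) * (t - u) ^ ?n)) / fact (Suc ?n)) = v $ i * (?P * (t - u) ^ ?n / fact ?n)"
        by (simp add: fact_Suc field_simps del: of_nat_Suc)
      ultimately show "(?F has_vector_derivative v $ i * (?P * (t - u) ^ ?n / fact ?n)) (at u within {s..t})"
        by (simp add: has_real_derivative_iff_has_vector_derivative)
    qed (use Cons in \<open>auto intro!: continuous_intros\<close>)
    then show ?thesis by simp
  qed
  finally show ?case by simp
qed simp

subsection \<open>Dyadic interpolations\<close>

lemma dyadic_interp_vector_derivative:
  assumes "real r / 2 ^ m < u" "u < real (Suc r) / 2 ^ m"
  shows "vector_derivative (dyadic_interp m h) (at u) =
    2 ^ m *\<^sub>R (h (real (Suc r) / 2 ^ m) - h (real r / 2 ^ m))"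
proof (rule vector_derivative_at)
  let ?S = "{real r / 2 ^ m<..<real (Suc r) / 2 ^ m}"
  let ?D = "h (real (Suc r) / 2 ^ m) - h (real r / 2 ^ m)"
  have "((\<lambda>v. h (real r / 2 ^ m) + (2 ^ m * v - real r) *\<^sub>R ?D) has_vector_derivative 2 ^ m *\<^sub>R ?D) (at u)"
    by (auto intro!: derivative_eq_intros)
  then show "(dyadic_interp m h has_vector_derivative 2 ^ m *\<^sub>R ?D) (at u)"
  proof (rule has_vector_derivative_transform_within_open[where S = ?S])
    fix v assume "v \<in> ?S"
    then have "real r < 2 ^ m * v" "2 ^ m * v < real r + 1" by (auto simp: field_simps)
    then have "\<lfloor>2 ^ m * v\<rfloor> = int r" by (intro floor_unique) auto
    then show "h (real r / 2 ^ m) + (2 ^ m * v - real r) *\<^sub>R ?D = dyadic_interp m h v"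
      by (simp add: dyadic_interp_def Let_def add.commute[of 1 "real r"])
  qed (use assms in auto)
qed

lemma dyadic_interp_derivative_integrable:
  "set_integrable lborel {0..1} (\<lambda>u. vector_derivative (dyadic_interp m h) (at u) $ i)"
proof -
  let ?I = "\<lambda>r. {real r / 2 ^ m..real (Suc r) / 2 ^ m}"
  have "set_integrable lborel (\<Union>r\<in>{..<2 ^ m}. ?I r) (\<lambda>u. vector_derivative (dyadic_interp m h) (at u) $ i)"
  proof (rule set_integrable_UN)
    fix r
    let ?d = "(2 ^ m *\<^sub>R (h (real (Suc r) / 2 ^ m) - h (real r / 2 ^ m))) $ i"
    have "integrable lborel (\<lambda>u. indicat_real (?I r) u *\<^sub>R ?d)"
      by (intro integrable_scaleR_left integrable_real_indicator) (auto simp: emeasure_lborel_Icc_eq)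
    then show "set_integrable lborel (?I r) (\<lambda>u. vector_derivative (dyadic_interp m h) (at u) $ i)"
      unfolding set_integrable_def
      by (rule integrable_discrete_difference_aux[where X = "{real r / 2 ^ m, real (Suc r) / 2 ^ m}"])
         (auto simp: indicator_def dyadic_interp_vector_derivative[of r] simp del: of_nat_Suc)
  qed auto
  then show ?thesis
  proof (rule set_integrable_subset)
    show "{0..1} \<subseteq> (\<Union>r\<in>{..<2 ^ m}. ?I r)"
    proof
      fix u :: real assume u: "u \<in> {0..1}"
      show "u \<in> (\<Union>r\<in>{..<2 ^ m}. ?I r)"
      \<comment> \<open>At \<open>u = 1\<close> the floor would give the index \<open>2 ^ m\<close>,
        one past the last interval.\<close>
      proof (cases "u = 1")
        case True
        then have "u \<in> ?I (2 ^ m - 1)" by (auto simp: of_nat_diff field_simps)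
        then show ?thesis by (intro UN_I[of "2 ^ m - 1"]) auto
      next
        case False
        define r where "r = nat \<lfloor>2 ^ m * u\<rfloor>"
        have r: "real r = of_int \<lfloor>2 ^ m * u\<rfloor>" using u by (simp add: r_def)
        then have "real r \<le> 2 ^ m * u" "2 ^ m * u < real r + 1" by linarith+
        moreover have "r < 2 ^ m"
        proof -
          have "2 ^ m * u < 2 ^ m * 1" using u False by (intro mult_strict_left_mono) auto
          with \<open>real r \<le> 2 ^ m * u\<close> have "real r < 2 ^ m * 1" by (rule le_less_trans)
          then have "real r < real (2 ^ m)" by simp
          then show ?thesis by (simp only: of_nat_less_iff)
        qed
        ultimately have "u \<in> ?I r" "r < 2 ^ m" by (auto simp: field_simps)
        then show ?thesis by blast
      qed
    qed
  qed auto
qed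

text \<open>Intervals are numbered from 0, one less than in \<open>rough_dist\<close>, so that the
  halves of interval \<open>l\<close> are \<open>2 * l\<close> and \<open>Suc (2 * l)\<close> on the
  next level.\<close>

definition dyadic_integral :: "nat \<Rightarrow> (real \<Rightarrow> real ^ 'd) \<Rightarrow> nat \<Rightarrow> nat \<Rightarrow> 'd list \<Rightarrow> real" where
  "dyadic_integral m h n l w =
    iterated_integral (dyadic_interp m h) (real l / 2 ^ n) (real (Suc l) / 2 ^ n) w"

definition dyadic_incr :: "(real \<Rightarrow> real ^ 'd) \<Rightarrow> nat \<Rightarrow> nat \<Rightarrow> 'd \<Rightarrow> real" where
  "dyadic_incr h n l i = h (real (Suc l) / 2 ^ n) $ i - h (real l / 2 ^ n) $ i"

lemma dyadic_integral_chen: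
  fixes h :: "real \<Rightarrow> real ^ 'd::finite"
  assumes "l < 2 ^ n"
  shows "dyadic_integral m h n l w = (\<Sum>k\<le>length w.
    dyadic_integral m h (Suc n) (2 * l) (take k w) * dyadic_integral m h (Suc n) (Suc (2 * l)) (drop k w))"
proof -
  have "real (Suc l) \<le> 2 ^ n" using assms by (metis Suc_leI of_nat_le_iff of_nat_numeral of_nat_power)
  then have "real (Suc l) / 2 ^ n \<le> 1" by simp
  moreover have "real (2 * l) / 2 ^ Suc n = real l / 2 ^ n"
    "real (Suc (Suc (2 * l))) / 2 ^ Suc n = real (Suc l) / 2 ^ n"
    by (simp_all add: field_simps)
  moreover have "real l / 2 ^ n \<le> real (Suc (2 * l)) / 2 ^ Suc n"
     "real (Suc (2 * l)) / 2 ^ Suc n \<le> real (Suc l) / 2 ^ n"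
    by (simp_all add: field_simps)
  ultimately show ?thesis
    unfolding dyadic_integral_def
    by (simp only:) (intro chen_identity[where a = 0 and b = 1] dyadic_interp_derivative_integrable; simp)
qed

text \<open>Interval \<open>l\<close> of level \<open>n\<close> lies in interval
  \<open>l div 2 ^ (n - m)\<close> of level \<open>m\<close>, where the interpolation is linear, and
  takes the fraction \<open>1 / 2 ^ (n - m)\<close> of its increment.\<close>

lemma dyadic_integral_fine:
  assumes "m \<le> n"
  shows "dyadic_integral m h n l w =
    (\<Prod>i\<leftarrow>w. dyadic_incr h m (l div 2 ^ (n - m)) i) * (1 / 2 ^ (n - m)) ^ length w / fact (length w)"
proof -
  define r where "r = l div 2 ^ (n - m)"
  have pw: "(2::real) ^ n = 2 ^ m * 2 ^ (n - m)" using assms by (simp flip: power_add)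
  have "r * 2 ^ (n - m) \<le> l" by (simp add: r_def)
  then have "real r * 2 ^ (n - m) \<le> real l"
    by (metis of_nat_le_iff of_nat_mult of_nat_numeral of_nat_power)
  then have lo: "real r / 2 ^ m \<le> real l / 2 ^ n" by (simp add: pw field_simps)
  have "Suc l \<le> Suc r * 2 ^ (n - m)"
    using dividend_less_div_times[of "2 ^ (n - m)" l] by (simp add: r_def)
  then have "real (Suc l) \<le> real (Suc r) * 2 ^ (n - m)"
    by (metis of_nat_le_iff of_nat_mult of_nat_numeral of_nat_power)
  then have "real (Suc l) / 2 ^ n \<le> real (Suc r) * 2 ^ (n - m) / 2 ^ n" by (intro divide_right_mono) auto
  then have hi: "real (Suc l) / 2 ^ n \<le> real (Suc r) / 2 ^ m" by (simp add: pw)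
  have "dyadic_integral m h n l w =
     (\<Prod>i\<leftarrow>w. (2 ^ m *\<^sub>R (h (real (Suc r) / 2 ^ m) - h (real r / 2 ^ m))) $ i)
       * (real (Suc l) / 2 ^ n - real l / 2 ^ n) ^ length w / fact (length w)"
    unfolding dyadic_integral_def
    using lo hi
    by (intro iterated_integral_linear dyadic_interp_vector_derivative) (auto simp: divide_right_mono)
  also have "real (Suc l) / 2 ^ n - real l / 2 ^ n = 1 / 2 ^ n"
    by (simp add: field_simps)
  also have "(\<Prod>i\<leftarrow>w. (2 ^ m *\<^sub>R (h (real (Suc r) / 2 ^ m) - h (real r / 2 ^ m))) $ i) * (1 / 2 ^ n) ^ length w
      = (\<Prod>i\<leftarrow>w. dyadic_incr h m r i) * (1 / 2 ^ (n - m)) ^ length w"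
    by (induction w) (auto simp: dyadic_incr_def pw field_simps)
  finally show ?thesis by (simp add: r_def)
qed

lemma sum_pairs:
  fixes f :: "nat \<Rightarrow> 'a::comm_monoid_add"
  shows "(\<Sum>l<N. f (2 * l) + f (Suc (2 * l))) = (\<Sum>r<2 * N. f r)"
  by (induction N) (simp_all add: add.assoc)

lemma dyadic_incr_refine:
  "dyadic_incr h n l i = dyadic_incr h (Suc n) (2 * l) i + dyadic_incr h (Suc n) (Suc (2 * l)) i"
proof -
  have "real (2 * l) / 2 ^ Suc n = real l / 2 ^ n"
    "real (Suc (Suc (2 * l))) / 2 ^ Suc n = real (Suc l) / 2 ^ n"
    by (simp_all add: field_simps)
  then show ?thesis by (simp add: dyadic_incr_def del: of_nat_Suc)
qed

text \<open>Degree one does not depend on \<open>m\<close> as long as \<open>n \<le> m\<close>: the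
  increments of the halves add up, starting from level \<open>m\<close>. Only degrees two and three
  then produce an error.\<close>

lemma dyadic_integral_singleton:
  fixes h :: "real \<Rightarrow> real ^ 'd::finite"
  assumes "n \<le> m" "l < 2 ^ n"
  shows "dyadic_integral m h n l [i] = dyadic_incr h n l i"
  using assms
proof (induction n arbitrary: l rule: inc_induct)
  case base
  then show ?case by (simp add: dyadic_integral_fine)
next
  case (step n)
  then show ?case
    by (subst dyadic_integral_chen) (auto simp: dyadic_incr_refine[of h n] dyadic_integral_def[of _ _ _ _ "[]"])
qed

lemma dyadic_integral_Nil [simp]: "dyadic_integral m h n l [] = 1"
  by (simp add: dyadic_integral_def)

text \<open>The weights sum to \<open>1/3 + 1/3 + 4/6 = 4/3\<close>; the shape is that of the
  expansion in \<open>diff_norm_base3\<close>.\<close>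

lemma six_term_bound:
  fixes a b c d e f x :: real
  assumes "\<bar>a\<bar> \<le> x" "\<bar>b\<bar> \<le> x" "\<bar>c\<bar> \<le> x" "\<bar>d\<bar> \<le> x" "\<bar>e\<bar> \<le> x" "\<bar>f\<bar> \<le> x"
  shows "\<bar>a / 3 + b / 3 - (c + d + e + f) / 6\<bar> \<le> 4 / 3 * x"
  using assms[THEN abs_le_D1] assms[THEN abs_le_D2] by (intro abs_leI) (simp_all add: field_simps)

section \<open>Degrees two and three under an energy bound\<close>

lemma dyadic_integral_chen2:
  fixes h :: "real \<Rightarrow> real ^ 'd::finite"
  assumes "l < 2 ^ n"
  shows "dyadic_integral m h n l [i, j] = dyadic_integral m h (Suc n) (2 * l) [i, j]
    + dyadic_integral m h (Suc n) (2 * l) [i] * dyadic_integral m h (Suc n) (Suc (2 * l)) [j]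
    + dyadic_integral m h (Suc n) (Suc (2 * l)) [i, j]"
  by (subst dyadic_integral_chen[OF assms]) (simp add: numeral_eq_Suc)

lemma dyadic_integral_chen3:
  fixes h :: "real \<Rightarrow> real ^ 'd::finite"
  assumes "l < 2 ^ n"
  shows "dyadic_integral m h n l [i, j, k] = dyadic_integral m h (Suc n) (2 * l) [i, j, k]
    + dyadic_integral m h (Suc n) (2 * l) [i, j] * dyadic_integral m h (Suc n) (Suc (2 * l)) [k]
    + dyadic_integral m h (Suc n) (2 * l) [i] * dyadic_integral m h (Suc n) (Suc (2 * l)) [j, k]
    + dyadic_integral m h (Suc n) (Suc (2 * l)) [i, j, k]"
  by (subst dyadic_integral_chen[OF assms]) (simp add: numeral_eq_Suc)

text \<open>The path enters only through the energy bound, so the constants are uniform over the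
  ball. \<open>\<beta> \<ge> 1\<close> lets lower powers of \<beta> be absorbed into
  \<open>\<beta> ^ 3\<close>; \<open>1/2 \<le> \<theta>\<close> makes the decay of a linear piece
  under halving at least as fast as that of powers of \<theta>.\<close>

locale rough_path_scale =
  fixes h :: "real \<Rightarrow> real ^ 'd::finite" and \<beta> \<theta> :: real
  assumes \<beta>: "\<beta> \<ge> 1" and \<theta>: "1/2 \<le> \<theta>" "\<theta> < 1"
    and energy: "\<And>k i. (\<Sum>r<2 ^ k. (dyadic_incr h k r i)\<^sup>2) \<le> \<beta>\<^sup>2 * \<theta> ^ (2 * k)"
begin

text \<open>Chosen for the downward induction in \<open>diff_norm3\<close>: 4 covers the base case,
  and \<open>1 / (1 - \<theta>)\<close> makes
  \<open>(K + \<theta>\<^sup>2) * \<theta> \<le> K\<close>, which is the induction step.\<close>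

definition "K = 4 + 1 / (1 - \<theta>)"

definition diff_norm :: "nat \<Rightarrow> nat \<Rightarrow> 'd list \<Rightarrow> real" where
  "diff_norm m n w = (\<Sum>l<2 ^ n. \<bar>dyadic_integral (Suc m) h n l w - dyadic_integral m h n l w\<bar>)"

lemma incr_bound: "r < 2 ^ k \<Longrightarrow> \<bar>dyadic_incr h k r i\<bar> \<le> \<beta> * \<theta> ^ k"
proof -
  assume "r < 2 ^ k"
  then have "(dyadic_incr h k r i)\<^sup>2 \<le> (\<Sum>r<2 ^ k. (dyadic_incr h k r i)\<^sup>2)"
    by (intro member_le_sum) auto
  also have "\<dots> \<le> (\<beta> * \<theta> ^ k)\<^sup>2"
    using energy[of k i] by (simp add: power_mult_distrib power_mult[symmetric] mult.commute)
  finally show ?thesis using \<beta> \<theta> by (simp add: abs_le_square_iff[symmetric])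
qed

lemma energy_pairs:
  "(\<Sum>l<2 ^ m. (dyadic_incr h (Suc m) (2 * l) i)\<^sup>2 + (dyadic_incr h (Suc m) (Suc (2 * l)) i)\<^sup>2)
     \<le> \<beta>\<^sup>2 * \<theta> ^ (2 * Suc m)"
  using energy[of "Suc m" i] sum_pairs[of "\<lambda>r. (dyadic_incr h (Suc m) r i)\<^sup>2" "2 ^ m"] by simp

lemma child_lt: "l < 2 ^ n \<Longrightarrow> 2 * l < 2 ^ Suc n" "l < 2 ^ n \<Longrightarrow> Suc (2 * l) < 2 ^ Suc n"
  by auto

lemma child_singleton:
  assumes "l < 2 ^ n" "Suc n \<le> m"
  shows "dyadic_integral m h (Suc n) (2 * l) [i] = dyadic_incr h (Suc n) (2 * l) i"
    and "dyadic_integral m h (Suc n) (Suc (2 * l)) [i] = dyadic_incr h (Suc n) (Suc (2 * l)) i"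
  using assms by (auto intro!: dyadic_integral_singleton child_lt)

text \<open>With \<open>L\<close> and \<open>R\<close> the increments over the two halves, the
  difference is the area \<open>(L i * R j - R i * L j) / 2\<close>, bounded by a quarter of the
  squares involved. Summing over the intervals gives two energies of level
  \<open>Suc m\<close>.\<close>

lemma diff_norm_base2:
  "diff_norm m m [i, j] \<le> \<beta>\<^sup>2 * \<theta> ^ (2 * Suc m) / 2"
proof -
  define L where "L l = dyadic_incr h (Suc m) (2 * l)" for l
  define R where "R l = dyadic_incr h (Suc m) (Suc (2 * l))" for l
  have "\<bar>dyadic_integral (Suc m) h m l [i, j] - dyadic_integral m h m l [i, j]\<bar>
      \<le> (((L l i)\<^sup>2 + (R l i)\<^sup>2) + ((L l j)\<^sup>2 + (R l j)\<^sup>2)) / 4" if "l < 2 ^ m" for l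
  proof -
    have "dyadic_integral m h m l [i, j] = (L l i + R l i) * (L l j + R l j) / 2"
      by (simp add: dyadic_integral_fine dyadic_incr_refine[of h m] L_def R_def)
    moreover have "dyadic_integral (Suc m) h m l [i, j] = L l i * L l j / 2 + L l i * R l j + R l i * R l j / 2"
      by (simp add: dyadic_integral_chen2[OF that] dyadic_integral_fine L_def R_def)
    ultimately have "dyadic_integral (Suc m) h m l [i, j] - dyadic_integral m h m l [i, j]
        = (L l i * R l j - R l i * L l j) / 2" by (simp add: field_simps)
    moreover have "0 \<le> (L l i - R l j)\<^sup>2" "0 \<le> (L l i + R l j)\<^sup>2" "0 \<le> (R l i - L l j)\<^sup>2" "0 \<le> (R l i + L l j)\<^sup>2"
      by simp_all
    ultimately show ?thesis
      unfolding power2_eq_square by (intro abs_leI) (simp_all add: algebra_simps)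
  qed
  then have "diff_norm m m [i, j] \<le> (\<Sum>l<2 ^ m. (((L l i)\<^sup>2 + (R l i)\<^sup>2) + ((L l j)\<^sup>2 + (R l j)\<^sup>2)) / 4)"
    unfolding diff_norm_def by (intro sum_mono) auto
  also have "\<dots> = ((\<Sum>l<2 ^ m. (L l i)\<^sup>2 + (R l i)\<^sup>2) + (\<Sum>l<2 ^ m. (L l j)\<^sup>2 + (R l j)\<^sup>2)) / 4"
    by (simp add: sum.distrib sum_divide_distrib add_divide_distrib)
  also have "\<dots> \<le> (\<beta>\<^sup>2 * \<theta> ^ (2 * Suc m) + \<beta>\<^sup>2 * \<theta> ^ (2 * Suc m)) / 4"
    unfolding L_def R_def by (intro divide_right_mono add_mono energy_pairs) auto
  also have "\<dots> = \<beta>\<^sup>2 * \<theta> ^ (2 * Suc m) / 2" by (simp del: power_Suc mult_Suc_right)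
  finally show ?thesis .
qed

text \<open>Going up a level, the cross term in Chen's identity is a product of increments common to
  both interpolations, so it cancels and the errors of the halves merely add.\<close>

lemma diff_norm2:
  assumes "n \<le> m"
  shows "diff_norm m n [i, j] \<le> \<beta>\<^sup>2 * \<theta> ^ (2 * Suc m) / 2"
  using assms
proof (induction n rule: inc_induct)
  case base
  show ?case by (rule diff_norm_base2)
next
  case (step n)
  let ?b = "\<lambda>l. dyadic_integral (Suc m) h (Suc n) l [i, j] - dyadic_integral m h (Suc n) l [i, j]"
  have "dyadic_integral (Suc m) h n l [i, j] - dyadic_integral m h n l [i, j] = ?b (2 * l) + ?b (Suc (2 * l))"
    if "l < 2 ^ n" for l
    unfolding dyadic_integral_chen2[OF that]
    using step.hyps by (simp add: child_singleton[OF that])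
  then have "diff_norm m n [i, j] \<le> (\<Sum>l<2 ^ n. \<bar>?b (2 * l)\<bar> + \<bar>?b (Suc (2 * l))\<bar>)"
    unfolding diff_norm_def by (intro sum_mono) auto
  also have "\<dots> = diff_norm m (Suc n) [i, j]"
    unfolding diff_norm_def using sum_pairs[of "\<lambda>r. \<bar>?b r\<bar>" "2 ^ n"] by simp
  finally show ?case using step.IH by simp
qed

text \<open>The difference is a combination of triple products of increments over halves. The factor
  with index \<open>i\<close> is bounded uniformly by \<open>q\<close>, the other two by the energy;
  weight \<open>4/3\<close> and three energies give the constant 4.\<close>

lemma diff_norm_base3:
  "diff_norm m m [i, j, k] \<le> 4 * \<beta> ^ 3 * \<theta> ^ (3 * Suc m)"
proof -
  define L where "L l = dyadic_incr h (Suc m) (2 * l)" for l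
  define R where "R l = dyadic_incr h (Suc m) (Suc (2 * l))" for l
  define q where "q = \<beta> * \<theta> ^ Suc m"
  define E where "E l = ((L l i)\<^sup>2 + (R l i)\<^sup>2) + ((L l j)\<^sup>2 + (R l j)\<^sup>2) + ((L l k)\<^sup>2 + (R l k)\<^sup>2)" for l
  have q: "q \<ge> 0" using \<beta> \<theta> by (simp add: q_def)
  have "\<bar>dyadic_integral (Suc m) h m l [i, j, k] - dyadic_integral m h m l [i, j, k]\<bar>
      \<le> 4 / 3 * (q * E l)" if "l < 2 ^ m" for l
  proof -
    have mono: "\<bar>x * y * z\<bar> \<le> q * E l" if "\<bar>x\<bar> \<le> q" "y\<^sup>2 + z\<^sup>2 \<le> E l" for x y z
    proof -
      have "\<bar>x * y * z\<bar> = \<bar>x\<bar> * (\<bar>y\<bar> * \<bar>z\<bar>)" by (simp add: abs_mult)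
      also have "\<dots> \<le> q * E l"
      proof (intro mult_mono)
        have "2 * (\<bar>y\<bar> * \<bar>z\<bar>) \<le> E l" "0 \<le> \<bar>y\<bar> * \<bar>z\<bar>"
          using that sum_squares_bound[of "\<bar>y\<bar>" "\<bar>z\<bar>"] by (auto simp: mult.assoc)
        then show "\<bar>y\<bar> * \<bar>z\<bar> \<le> E l" by linarith
      qed (use that q in auto)
      finally show ?thesis .
    qed
    have Lq: "\<bar>L l i\<bar> \<le> q" "\<bar>R l i\<bar> \<le> q"
      unfolding L_def R_def q_def using that by (intro incr_bound; simp)+
    have E: "(L l j)\<^sup>2 + (L l k)\<^sup>2 \<le> E l" "(L l j)\<^sup>2 + (R l k)\<^sup>2 \<le> E l"
      "(R l j)\<^sup>2 + (L l k)\<^sup>2 \<le> E l" "(R l j)\<^sup>2 + (R l k)\<^sup>2 \<le> E l"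
      by (auto simp: E_def)
    have "dyadic_integral m h m l [i, j, k] = (L l i + R l i) * (L l j + R l j) * (L l k + R l k) / 6"
      by (simp add: dyadic_integral_fine dyadic_incr_refine[of h m] L_def R_def fact_numeral)
    moreover have "dyadic_integral (Suc m) h m l [i, j, k] = L l i * L l j * L l k / 6
        + L l i * L l j * R l k / 2 + L l i * R l j * R l k / 2 + R l i * R l j * R l k / 6"
      by (simp add: dyadic_integral_chen3[OF that] dyadic_integral_fine L_def R_def fact_numeral)
    \<comment> \<open>The pure products of \<open>L\<close> and of \<open>R\<close> cancel;
      \<open>1/2 - 1/6\<close> leaves \<open>1/3\<close> for the two time-ordered mixed products and
      \<open>- 1/6\<close> remains for the other four.\<close>
    ultimately have eq: "dyadic_integral (Suc m) h m l [i, j, k] - dyadic_integral m h m l [i, j, k]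
        = L l i * L l j * R l k / 3 + L l i * R l j * R l k / 3
          - (R l i * R l j * L l k + R l i * L l j * R l k + L l i * R l j * L l k + R l i * L l j * L l k) / 6"
      by (simp add: field_simps)
    then show ?thesis
      using Lq E by (simp only:) (intro six_term_bound mono)
  qed
  then have "diff_norm m m [i, j, k] \<le> (\<Sum>l<2 ^ m. 4 / 3 * (q * E l))"
    unfolding diff_norm_def by (intro sum_mono) auto
  also have "\<dots> = 4 / 3 * q * (\<Sum>l<2 ^ m. E l)"
    by (simp add: sum_distrib_left mult.assoc)
  also have "\<dots> \<le> 4 / 3 * q * (\<beta>\<^sup>2 * \<theta> ^ (2 * Suc m) + \<beta>\<^sup>2 * \<theta> ^ (2 * Suc m) + \<beta>\<^sup>2 * \<theta> ^ (2 * Suc m))"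
  proof (intro mult_left_mono)
    have "(\<Sum>l<2 ^ m. E l) = (\<Sum>l<2 ^ m. (L l i)\<^sup>2 + (R l i)\<^sup>2) + (\<Sum>l<2 ^ m. (L l j)\<^sup>2 + (R l j)\<^sup>2)
        + (\<Sum>l<2 ^ m. (L l k)\<^sup>2 + (R l k)\<^sup>2)"
      by (simp only: E_def sum.distrib)
    also have "\<dots> \<le> \<beta>\<^sup>2 * \<theta> ^ (2 * Suc m) + \<beta>\<^sup>2 * \<theta> ^ (2 * Suc m) + \<beta>\<^sup>2 * \<theta> ^ (2 * Suc m)"
      unfolding L_def R_def by (intro add_mono energy_pairs)
    finally show "(\<Sum>l<2 ^ m. E l)
        \<le> \<beta>\<^sup>2 * \<theta> ^ (2 * Suc m) + \<beta>\<^sup>2 * \<theta> ^ (2 * Suc m) + \<beta>\<^sup>2 * \<theta> ^ (2 * Suc m)" .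
  qed (use q in auto)
  also have "\<dots> = 4 * \<beta> ^ 3 * (\<theta> ^ Suc m * \<theta> ^ (2 * Suc m))"
    by (simp add: q_def power2_eq_square power3_eq_cube del: power_Suc mult_Suc_right)
  also have "\<theta> ^ Suc m * \<theta> ^ (2 * Suc m) = \<theta> ^ (3 * Suc m)"
    unfolding power_add[symmetric] by (rule arg_cong[where f = "(^) \<theta>"]) simp
  finally show ?thesis .
qed

text \<open>The cross terms now leave a degree-two error times an increment, of order
  \<open>\<theta> ^ (2 * m) * \<theta> ^ n\<close>. The bound at level \<open>Suc n\<close> is
  smaller by a factor \<theta> than the one wanted at level \<open>n\<close>, and this slack pays
  for them.\<close>

lemma diff_norm3:
  assumes "n \<le> m"
  shows "diff_norm m n [i, j, k] \<le> \<beta> ^ 3 * K * \<theta> ^ (2 * m) * \<theta> ^ n"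
  using assms
proof (induction n rule: inc_induct)
  case base
  have "4 * \<theta> ^ (3 * Suc m) \<le> K * \<theta> ^ (3 * m)"
    using \<theta> by (intro mult_mono power_decreasing) (auto simp: K_def)
  then have "\<beta> ^ 3 * (4 * \<theta> ^ (3 * Suc m)) \<le> \<beta> ^ 3 * (K * \<theta> ^ (3 * m))"
    using \<beta> by (intro mult_left_mono) auto
  then have "4 * \<beta> ^ 3 * \<theta> ^ (3 * Suc m) \<le> \<beta> ^ 3 * K * \<theta> ^ (3 * m)" by (simp only: mult_ac)
  moreover have "\<theta> ^ (3 * m) = \<theta> ^ (2 * m) * \<theta> ^ m" by (simp flip: power_add)
  ultimately show ?case using diff_norm_base3[of m i j k] by (simp add: mult.assoc)
next
  case (step n)
  let ?b = "\<lambda>w l. dyadic_integral (Suc m) h (Suc n) l w - dyadic_integral m h (Suc n) l w"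
  define q where "q = \<beta> * \<theta> ^ Suc n"
  have q: "q \<ge> 0" using \<beta> \<theta> by (simp add: q_def)
  have "\<bar>dyadic_integral (Suc m) h n l [i, j, k] - dyadic_integral m h n l [i, j, k]\<bar> \<le>
      (\<bar>?b [i,j,k] (2 * l)\<bar> + \<bar>?b [i,j,k] (Suc (2 * l))\<bar>)
      + q * (\<bar>?b [i,j] (2 * l)\<bar> + \<bar>?b [i,j] (Suc (2 * l))\<bar>) + q * (\<bar>?b [j,k] (2 * l)\<bar> + \<bar>?b [j,k] (Suc (2 * l))\<bar>)"
    (is "?A l \<le> ?f l + q * ?g l + q * ?k l") if "l < 2 ^ n" for l
  proof -
    define L where "L = dyadic_incr h (Suc n) (2 * l) i"
    define R where "R = dyadic_incr h (Suc n) (Suc (2 * l)) k"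
    have "dyadic_integral (Suc m) h n l [i, j, k] - dyadic_integral m h n l [i, j, k] =
       ?b [i,j,k] (2 * l) + ?b [i,j,k] (Suc (2 * l)) + ?b [i,j] (2 * l) * R + L * ?b [j,k] (Suc (2 * l))"
      unfolding dyadic_integral_chen3[OF that] L_def R_def
      using step.hyps by (simp add: child_singleton[OF that] left_diff_distrib right_diff_distrib)
    then have "\<bar>dyadic_integral (Suc m) h n l [i, j, k] - dyadic_integral m h n l [i, j, k]\<bar> \<le>
       \<bar>?b [i,j,k] (2 * l)\<bar> + \<bar>?b [i,j,k] (Suc (2 * l))\<bar> + \<bar>?b [i,j] (2 * l) * R\<bar> + \<bar>L * ?b [j,k] (Suc (2 * l))\<bar>"
      by (simp only:)
    \<comment> \<open>The errors over the sibling intervals are added so that the sum over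
      \<open>l\<close> becomes a full \<open>diff_norm\<close> of level
      \<open>Suc n\<close>.\<close>
    also have "\<dots> \<le> (\<bar>?b [i,j,k] (2 * l)\<bar> + \<bar>?b [i,j,k] (Suc (2 * l))\<bar>)
      + q * (\<bar>?b [i,j] (2 * l)\<bar> + \<bar>?b [i,j] (Suc (2 * l))\<bar>) + q * (\<bar>?b [j,k] (2 * l)\<bar> + \<bar>?b [j,k] (Suc (2 * l))\<bar>)"
    proof (intro add_mono order_refl)
      have "\<bar>L\<bar> \<le> q" "\<bar>R\<bar> \<le> q"
        unfolding L_def R_def q_def
        by (rule incr_bound[OF child_lt(1)[OF that]]) (rule incr_bound[OF child_lt(2)[OF that]])
      then show "\<bar>?b [i,j] (2 * l) * R\<bar> \<le> q * (\<bar>?b [i,j] (2 * l)\<bar> + \<bar>?b [i,j] (Suc (2 * l))\<bar>)"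
        and "\<bar>L * ?b [j,k] (Suc (2 * l))\<bar> \<le> q * (\<bar>?b [j,k] (2 * l)\<bar> + \<bar>?b [j,k] (Suc (2 * l))\<bar>)"
        unfolding abs_mult mult.commute[of _ "\<bar>R\<bar>"] using q by (auto intro!: mult_mono)
    qed
    finally show ?thesis .
  qed
  then have "diff_norm m n [i, j, k] \<le> (\<Sum>l<2 ^ n. ?f l + q * ?g l + q * ?k l)"
    unfolding diff_norm_def by (intro sum_mono) (simp only: lessThan_iff)
  also have "\<dots> = (\<Sum>l<2 ^ n. ?f l) + q * (\<Sum>l<2 ^ n. ?g l) + q * (\<Sum>l<2 ^ n. ?k l)"
    unfolding sum_distrib_left sum.distrib[symmetric] ..
  also have "\<dots> = diff_norm m (Suc n) [i,j,k] + q * diff_norm m (Suc n) [i,j] + q * diff_norm m (Suc n) [j,k]"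
    unfolding diff_norm_def power_Suc sum_pairs[symmetric] ..
  also have "\<dots> \<le> \<beta> ^ 3 * K * \<theta> ^ (2 * m) * \<theta> ^ Suc n + q * (\<beta>\<^sup>2 * \<theta> ^ (2 * Suc m) / 2) + q * (\<beta>\<^sup>2 * \<theta> ^ (2 * Suc m) / 2)"
    using step q by (intro add_mono mult_left_mono diff_norm2) auto
  also have "\<dots> = \<beta> ^ 3 * \<theta> ^ (2 * m) * \<theta> ^ n * ((K + \<theta>\<^sup>2) * \<theta>)"
    by (simp add: q_def power3_eq_cube power2_eq_square algebra_simps)
  also have "\<dots> \<le> \<beta> ^ 3 * \<theta> ^ (2 * m) * \<theta> ^ n * K"
  proof (intro mult_left_mono)
    have "\<theta> ^ 3 \<le> 1" using \<theta> by (intro power_le_one) auto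
    moreover have "K * (1 - \<theta>) = 4 * (1 - \<theta>) + 1" using \<theta> by (simp add: K_def field_simps)
    ultimately have "\<theta> ^ 3 \<le> K * (1 - \<theta>)" using \<theta> by auto
    then show "(K + \<theta>\<^sup>2) * \<theta> \<le> K" by (simp add: power3_eq_cube power2_eq_square algebra_simps)
  qed (use \<beta> \<theta> in auto)
  finally show ?case by (simp add: mult_ac)
qed

text \<open>One interval's error is at most the sum over all of them. Splitting off
  \<open>\<theta> ^ (length w * n)\<close>, the natural size at level \<open>n\<close>, leaves the
  gain \<open>\<theta> ^ (2 * (m - n))\<close> in both degrees two and three.\<close>

lemma diff_step:
  assumes w: "length w \<in> {1, 2, 3}" and "n \<le> m" "l < 2 ^ n"
  shows "\<bar>dyadic_integral (Suc m) h n l w - dyadic_integral m h n l w\<bar>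
    \<le> \<beta> ^ 3 * K * \<theta> ^ (2 * (m - n)) * \<theta> ^ (length w * n)"
proof -
  have K: "K \<ge> 4" using \<theta> by (simp add: K_def)
  have nn: "0 \<le> \<beta> ^ 3 * K * \<theta> ^ (2 * (m - n)) * \<theta> ^ (length w * n)" using K \<beta> \<theta> by auto
  have le: "\<bar>dyadic_integral (Suc m) h n l w - dyadic_integral m h n l w\<bar> \<le> diff_norm m n w"
    unfolding diff_norm_def
    using assms by (intro member_le_sum[where f = "\<lambda>l. \<bar>dyadic_integral (Suc m) h n l w - dyadic_integral m h n l w\<bar>"]) auto
  consider i where "w = [i]" | i j where "w = [i, j]" | i j k where "w = [i, j, k]"
    using w by (auto simp: numeral_eq_Suc length_Suc_conv)
  then show ?thesis
  proof cases
    case 1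
    then show ?thesis using assms nn by (simp add: dyadic_integral_singleton)
  next
    case (2 i j)
    have "\<theta> ^ (2 * (m - n)) * \<theta> ^ (2 * n) = \<theta> ^ (2 * m)"
      using assms(2) by (simp flip: power_add distrib_left)
    then have "\<theta> ^ (2 * m) = \<theta> ^ (2 * (m - n)) * \<theta> ^ (length w * n)" using 2 by (simp add: numeral_2_eq_2)
    moreover have "\<beta>\<^sup>2 * \<theta> ^ (2 * Suc m) / 2 \<le> \<beta> ^ 3 * K * \<theta> ^ (2 * m)"
    proof -
      have "\<beta>\<^sup>2 * (\<theta> ^ (2 * Suc m) / 2) \<le> \<beta> ^ 3 * (K * \<theta> ^ (2 * m))"
      proof (intro mult_mono power_increasing)
        have "\<theta> ^ (2 * Suc m) / 2 \<le> 1 * \<theta> ^ (2 * m)"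
          using \<theta> power_decreasing[of "2 * m" "2 * Suc m" \<theta>] by simp
        also have "\<dots> \<le> K * \<theta> ^ (2 * m)" using K \<theta> by (intro mult_right_mono) auto
        finally show "\<theta> ^ (2 * Suc m) / 2 \<le> K * \<theta> ^ (2 * m)" .
      qed (use \<beta> \<theta> in auto)
      then show ?thesis by (simp add: mult.assoc)
    qed
    ultimately show ?thesis
      using le diff_norm2[OF assms(2), of i j] unfolding 2 mult.assoc by simp
  next
    case (3 i j k)
    have "\<theta> ^ (2 * (m - n)) * \<theta> ^ (3 * n) = \<theta> ^ (2 * m) * \<theta> ^ n"
      using assms(2) by (simp add: algebra_simps flip: power_add)
    then have "\<theta> ^ (2 * m) * \<theta> ^ n = \<theta> ^ (2 * (m - n)) * \<theta> ^ (length w * n)" using 3 by (simp add: numeral_3_eq_3)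
    then show ?thesis
      using le diff_norm3[OF assms(2), of i j k] unfolding 3 mult.assoc by simp
  qed
qed

text \<open>The constant of \<open>diff_step\<close> summed over all successive refinements, a
  geometric series of ratio \<open>\<theta>\<^sup>2\<close>.\<close>

definition "C = \<beta> ^ 3 * K / (1 - \<theta>\<^sup>2)"

lemma theta_sq: "\<theta>\<^sup>2 < 1" "0 < \<theta>\<^sup>2"
  using \<theta> power_strict_decreasing[of 0 2 \<theta>] by auto

lemma diff_bound:
  assumes w: "length w \<in> {1, 2, 3}" and "n \<le> m" "l < 2 ^ n" "m \<le> m'"
  shows "\<bar>dyadic_integral m' h n l w - dyadic_integral m h n l w\<bar>
    \<le> C * \<theta> ^ (2 * (m - n)) * \<theta> ^ (length w * n)"
proof -
  let ?T = "\<beta> ^ 3 * K * \<theta> ^ (length w * n)"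
  have T: "?T \<ge> 0" using \<beta> \<theta> by (simp add: K_def)
  have "\<bar>dyadic_integral (m + d) h n l w - dyadic_integral m h n l w\<bar>
      \<le> (\<Sum>k<d. ?T * (\<theta>\<^sup>2 ^ (m - n) * \<theta>\<^sup>2 ^ k))" for d
  proof (induction d)
    case (Suc d)
    have "\<theta>\<^sup>2 ^ (m + d - n) = \<theta>\<^sup>2 ^ (m - n) * \<theta>\<^sup>2 ^ d"
      using assms by (simp flip: power_add)
    then have "\<bar>dyadic_integral (Suc (m + d)) h n l w - dyadic_integral (m + d) h n l w\<bar>
      \<le> ?T * (\<theta>\<^sup>2 ^ (m - n) * \<theta>\<^sup>2 ^ d)"
      using diff_step[of w n "m + d" l] assms by (simp add: power_mult mult_ac)
    then show ?case using Suc by simp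
  qed simp
  from this[of "m' - m"] have "\<bar>dyadic_integral m' h n l w - dyadic_integral m h n l w\<bar>
      \<le> ?T * \<theta>\<^sup>2 ^ (m - n) * (\<Sum>k<m' - m. \<theta>\<^sup>2 ^ k)"
    using assms by (simp add: sum_distrib_left mult.assoc)
  also have "\<dots> \<le> ?T * \<theta>\<^sup>2 ^ (m - n) * (1 / (1 - \<theta>\<^sup>2))"
  proof (intro mult_left_mono)
    have "(\<Sum>k<m' - m. \<theta>\<^sup>2 ^ k) \<le> (\<Sum>k. \<theta>\<^sup>2 ^ k)"
      using theta_sq by (intro sum_le_suminf summable_geometric) auto
    also have "\<dots> = 1 / (1 - \<theta>\<^sup>2)" using theta_sq by (intro suminf_geometric) auto
    finally show "(\<Sum>k<m' - m. \<theta>\<^sup>2 ^ k) \<le> 1 / (1 - \<theta>\<^sup>2)" .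
  qed (use T in auto)
  finally show ?thesis unfolding C_def power_mult[of \<theta> 2] by (simp add: mult_ac)
qed

lemma fine_bound:
  assumes "m \<le> n" "l < 2 ^ n"
  shows "\<bar>dyadic_integral m h n l w\<bar> \<le> \<beta> ^ length w * \<theta> ^ (length w * n)"
proof -
  let ?r = "l div 2 ^ (n - m)"
  have r: "?r < 2 ^ m"
    using assms by (intro less_mult_imp_div_less) (simp flip: power_add)
  have "\<bar>\<Prod>i\<leftarrow>w. dyadic_incr h m ?r i\<bar> \<le> (\<beta> * \<theta> ^ m) ^ length w"
  proof (induction w)
    case (Cons i w)
    then show ?case using \<beta> \<theta> incr_bound[OF r, of i] by (auto simp: abs_mult intro!: mult_mono)
  qed simp
  moreover have "\<bar>dyadic_integral m h n l w\<bar>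
      = \<bar>\<Prod>i\<leftarrow>w. dyadic_incr h m ?r i\<bar> * (1 / 2 ^ (n - m)) ^ length w / fact (length w)"
    using assms by (simp add: dyadic_integral_fine abs_mult)
  ultimately have "\<bar>dyadic_integral m h n l w\<bar> \<le> (\<beta> * \<theta> ^ m) ^ length w * (1 / 2 ^ (n - m)) ^ length w / 1"
    by (simp only:) (intro frac_le mult_right_mono, auto)
  also have "\<dots> = (\<beta> * (\<theta> ^ m * (1 / 2) ^ (n - m))) ^ length w"
    by (simp add: power_mult_distrib power_divide)
  also have "\<dots> \<le> (\<beta> * \<theta> ^ n) ^ length w"
  proof (intro power_mono mult_left_mono)
    have "\<theta> ^ m * (1 / 2) ^ (n - m) \<le> \<theta> ^ m * \<theta> ^ (n - m)"
      using \<theta> by (intro mult_left_mono power_mono) auto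
    then show "\<theta> ^ m * (1 / 2) ^ (n - m) \<le> \<theta> ^ n" using assms by (simp flip: power_add)
  qed (use \<beta> \<theta> in auto)
  finally show ?thesis by (simp add: power_mult_distrib power_mult[symmetric] mult.commute)
qed

text \<open>For \<open>m \<le> n\<close> the path is linear on the interval and
  \<open>fine_bound\<close> applies. For \<open>m > n\<close> the interpolation of level
  \<open>n\<close> serves as reference: its own bound and \<open>diff_bound\<close> contribute one
  \<open>C\<close> each.\<close>

lemma bound:
  assumes w: "length w \<in> {1, 2, 3}" and l: "l < 2 ^ n"
  shows "\<bar>dyadic_integral m h n l w\<bar> \<le> 2 * C * \<theta> ^ (length w * n)"
proof -
  have "\<beta> ^ length w \<le> \<beta> ^ 3 * 1"
    unfolding mult_1_right using w \<beta> by (intro power_increasing) auto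
  also have "\<dots> \<le> \<beta> ^ 3 * (K / (1 - \<theta>\<^sup>2))"
  proof (intro mult_left_mono)
    have "1 - \<theta>\<^sup>2 \<le> K" 
    proof -
      have "0 \<le> 1 / (1 - \<theta>)" using \<theta> by simp
      then show ?thesis using theta_sq by (simp only: K_def)
    qed
    then show "1 \<le> K / (1 - \<theta>\<^sup>2)" using theta_sq by simp
  qed (use \<beta> in auto)
  finally have bC: "\<beta> ^ length w \<le> C" by (simp add: C_def)
  have "C \<ge> 0" using \<beta> \<theta> theta_sq by (simp add: C_def K_def)
  have fine: "\<bar>dyadic_integral k h n l w\<bar> \<le> C * \<theta> ^ (length w * n)" if "k \<le> n" for k
    using \<theta> by (intro order_trans[OF fine_bound[OF that l]] mult_right_mono bC) auto
  show ?thesis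
  proof (cases "m \<le> n")
    case True
    moreover have "0 \<le> C * \<theta> ^ (length w * n)" using \<open>C \<ge> 0\<close> \<theta> by simp
    ultimately show ?thesis using fine[of m] by simp
  next
    case False
    then show ?thesis using fine[of n] diff_bound[OF w order_refl l, of m] by simp
  qed
qed

end

subsection \<open>Summation over the levels\<close>

text \<open>Write \<open>r\<close> as the square of \<open>exp (- c)\<close>: one factor
  \<open>exp (- c) ^ n\<close> absorbs the power of \<open>n\<close>, the other remains as a
  geometric majorant.\<close>

lemma summable_powr_geometric:
  assumes "0 < r" "r < (1::real)"
  shows "summable (\<lambda>k. real (Suc k) powr g * r ^ Suc k)"
proof -
  define c where "c = - ln r / 2"
  have c: "c > 0" using assms by (simp add: c_def)
  have r: "r ^ n = exp (- c * real n) * exp (- c) ^ n" for n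
  proof -
    have "exp (- c) * exp (- c) = r" using assms by (simp add: c_def flip: exp_add)
    moreover have "exp (- c * real n) = exp (- c) ^ n" by (metis exp_of_nat_mult mult.commute)
    ultimately show ?thesis by (simp only: power_mult_distrib[symmetric])
  qed
  have "(\<lambda>n::nat. real n powr g * exp (- c * real n)) \<longlonglongrightarrow> 0"
    using c by real_asymp
  then have "Bseq (\<lambda>n::nat. real n powr g * exp (- c * real n))"
    by (intro convergent_imp_Bseq convergentI)
  then obtain B where B: "\<And>n::nat. norm (real n powr g * exp (- c * real n)) \<le> B"
    unfolding Bseq_def by auto
  have "summable (\<lambda>n::nat. real n powr g * r ^ n)"
  proof (rule summable_comparison_test')
    show "summable (\<lambda>n. B * exp (- c) ^ n)"
      using c by (intro summable_mult summable_geometric) simp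
    show "norm (real n powr g * r ^ n) \<le> B * exp (- c) ^ n" for n
    proof -
      have "norm (real n powr g * r ^ n) = norm (real n powr g * exp (- c * real n)) * exp (- c) ^ n"
        by (simp add: r abs_mult)
      also have "\<dots> \<le> B * exp (- c) ^ n" by (intro mult_right_mono B) auto
      finally show ?thesis .
    qed
  qed
  then show ?thesis by (subst summable_Suc_iff)
qed

lemma tensor_norm_le:
  fixes a :: "'d::finite list \<Rightarrow> real"
  assumes "\<And>w. length w = j \<Longrightarrow> \<bar>a w\<bar> \<le> e"
  shows "tensor_norm j a \<le> sqrt (real (card {w :: 'd list. length w = j})) * e"
proof -
  have e: "e \<ge> 0" using assms[of "replicate j undefined"] by simp
  have "(\<Sum>w | length w = j. (a w)\<^sup>2) \<le> (\<Sum>w :: 'd list | length w = j. e\<^sup>2)"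
    using assms e by (intro sum_mono) (simp add: abs_le_square_iff[symmetric])
  then have "tensor_norm j a \<le> sqrt (real (card {w :: 'd list. length w = j}) * e\<^sup>2)"
    unfolding tensor_norm_def by simp
  then show ?thesis using e by (simp add: real_sqrt_mult)
qed

text \<open>Reduces the distance to a coordinatewise bound \<open>e n\<close> valid on all intervals
  of level \<open>n\<close>. A summable majorant makes the series finite, so it can be computed over
  the reals; \<open>f\<close> has index \<open>n - 1\<close> because the series starts at level
  1.\<close>

lemma rough_dist_le:
  fixes X Y :: "real \<Rightarrow> real \<Rightarrow> 'd::finite list \<Rightarrow> real" and p :: real and j :: nat
  defines "c \<equiv> sqrt (real (card {w :: 'd list. length w = j}))"
  assumes "p > 0" "j > 0"
    and e: "\<And>n l w. l < 2 ^ n \<Longrightarrow> length w = j \<Longrightarrow>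
      \<bar>X (real l / 2 ^ n) (real (Suc l) / 2 ^ n) w - Y (real l / 2 ^ n) (real (Suc l) / 2 ^ n) w\<bar> \<le> e n"
    and f: "\<And>n. n > 0 \<Longrightarrow> real n powr \<gamma> * 2 ^ n * (c * e n) powr (p / real j) \<le> f (n - 1)"
    and "summable f"
  shows "rough_dist \<gamma> j p X Y \<le> ennreal ((\<Sum>k. f k) powr (real j / p))"
proof -
  let ?T = "\<lambda>n l. tensor_norm j (\<lambda>w. X (real (l - 1) / 2 ^ n) (real l / 2 ^ n) w - Y (real (l - 1) / 2 ^ n) (real l / 2 ^ n) w)"
  let ?u = "\<lambda>k. real (Suc k) powr \<gamma> * (\<Sum>l = 1..2 ^ Suc k. ?T (Suc k) l powr (p / real j))"
  have u: "0 \<le> ?u k" "?u k \<le> f k" for k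
  proof -
    show "0 \<le> ?u k" by (intro mult_nonneg_nonneg sum_nonneg) auto
    have "(\<Sum>l = 1..2 ^ Suc k. ?T (Suc k) l powr (p / real j))
        \<le> (\<Sum>l::nat = 1..2 ^ Suc k. (c * e (Suc k)) powr (p / real j))"
    proof (intro sum_mono powr_mono2)
      fix l :: nat assume l: "l \<in> {1..2 ^ Suc k}"
      then obtain l' where l': "l = Suc l'" "l' < 2 ^ Suc k" by (cases l) auto
      show "?T (Suc k) l \<le> c * e (Suc k)"
        unfolding c_def using e[OF l'(2)] l' by (intro tensor_norm_le) simp
      show "0 \<le> ?T (Suc k) l" by (auto simp: tensor_norm_def intro: sum_nonneg)
    qed (use assms in auto)
    then have "?u k \<le> real (Suc k) powr \<gamma> * (2 ^ Suc k * (c * e (Suc k)) powr (p / real j))"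
      by (intro mult_left_mono) auto
    also have "\<dots> \<le> f k" using f[of "Suc k"] by (simp add: mult.assoc)
    finally show "?u k \<le> f k" .
  qed
  have su: "summable ?u"
    using u by (intro summable_comparison_test'[OF \<open>summable f\<close>]) auto
  have "rough_dist \<gamma> j p X Y = ennreal_rpow (\<Sum>k. ennreal (?u k)) (real j / p)"
    by (simp add: rough_dist_def Let_def)
  also have "(\<Sum>k. ennreal (?u k)) = ennreal (\<Sum>k. ?u k)"
    by (intro suminf_ennreal2 u su)
  also have "ennreal_rpow (ennreal (\<Sum>k. ?u k)) (real j / p) = ennreal ((\<Sum>k. ?u k) powr (real j / p))"
    using suminf_nonneg[OF su u(1)] by (simp add: ennreal_rpow_def)
  also have "\<dots> \<le> ennreal ((\<Sum>k. f k) powr (real j / p))"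
    using assms u su suminf_nonneg[OF su u(1)]
    by (intro ennreal_leI powr_mono2 suminf_le) auto
  finally show ?thesis .
qed

text \<open>The exponent \<open>p / j\<close> cancels the degree in \<open>j * n\<close>, so
  together with the \<open>2 ^ n\<close> intervals the ratio is \<open>2 powr (1 - p * H)\<close>
  for every \<open>j\<close>, less than 1 once \<open>p * H > 1\<close>. The factor \<eta> carries
  the gain from comparing two interpolations.\<close>

lemma level_term:
  assumes "0 < H" "p > 0" "j > 0" "a \<ge> 0" "0 \<le> \<eta>" 
  shows "real n powr \<gamma> * 2 ^ n * (a * (2 powr (- H)) ^ (j * n) * \<eta>) powr (p / real j)
    = a powr (p / real j) * (real n powr \<gamma> * (2 powr (1 - p * H)) ^ n) * \<eta> powr (p / real j)"
proof -
  have "((2 powr (- H)) ^ (j * n)) powr (p / real j) = (2::real) powr (- (p * H) * real n)"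
    using assms by (simp add: powr_realpow[symmetric] powr_powr mult_ac)
  moreover have "(2 powr (1 - p * H)) ^ n = 2 ^ n * (2::real) powr (- (p * H) * real n)"
    by (simp add: powr_realpow[symmetric] powr_powr powr_add[symmetric] algebra_simps)
  ultimately show ?thesis using assms by (simp add: powr_mult)
qed

section \<open>Application to the ball and passage to the limit\<close>

lemma filterlim_min_sequentially:
  "filterlim (\<lambda>(m, m'). min m m' :: nat) sequentially (sequentially \<times>\<^sub>F sequentially)"
  unfolding filterlim_at_top case_prod_unfold
proof
  fix Z :: nat
  show "\<forall>\<^sub>F x in sequentially \<times>\<^sub>F sequentially. Z \<le> min (fst x) (snd x)"
    unfolding eventually_prod_sequentially by auto
qed

lemma fbm_rkhs_ball_scale:
  fixes h :: "real \<Rightarrow> real ^ 'd::finite"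
  assumes H: "0 < H" "H < 1/2" and c: "fbm_normalizing H c" and "\<alpha> > 0"
    and h: "h \<in> fbm_rkhs_ball H c \<alpha>"
  shows "rough_path_scale h (sqrt 2 * \<alpha> + 1) (2 powr (- H))"
proof
  show "1 \<le> sqrt 2 * \<alpha> + 1" using \<open>\<alpha> > 0\<close> by simp
  have "(2::real) powr (- 1) \<le> 2 powr (- H)" using H by (intro powr_mono) auto
  then show "1 / 2 \<le> 2 powr (- H)" by (simp add: powr_minus)
  have "(2::real) powr (- H) < 2 powr 0" using H by (intro powr_less_mono) auto
  then show "2 powr (- H) < (1::real)" by simp
next
  fix k :: nat and i :: 'd
  \<comment> \<open>\<open>fbm_rkhs_norm\<close> is the norm of a chosen density; \<open>g\<close>
    is that choice.\<close>
  obtain g where g: "fbm_density H c h g" and gn: "L2_01_norm g \<le> \<alpha>"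
    using h someI_ex[of "fbm_density H c h"]
    unfolding fbm_rkhs_ball_def fbm_rkhs_def fbm_rkhs_norm_def by auto
  have g0: "0 \<le> L2_01_norm g" by (simp add: L2_01_norm_def set_lebesgue_integral_def)
  have "(\<Sum>r<2 ^ k. (dyadic_incr h k r i)\<^sup>2) \<le> 2 * (1 / real (2 ^ k)) powr (2 * H) * (L2_01_norm g)\<^sup>2"
    using fbm_density_increments[OF H c _ g, of "2 ^ k" i] by (simp add: dyadic_incr_def)
  also have "(1 / real (2 ^ k)) powr (2 * H) = (2 powr (- H)) ^ (2 * k)"
  proof -
    have "1 / real (2 ^ k) = 2 powr (- real k)" by (simp add: powr_minus powr_realpow divide_inverse)
    then show ?thesis by (simp add: powr_realpow[symmetric] powr_powr mult_ac)
  qed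
  also have "2 * (2 powr (- H)) ^ (2 * k) * (L2_01_norm g)\<^sup>2 \<le> 2 * (2 powr (- H)) ^ (2 * k) * \<alpha>\<^sup>2"
    using gn g0 by (intro mult_left_mono power_mono) auto
  also have "\<dots> = (sqrt 2 * \<alpha>)\<^sup>2 * (2 powr (- H)) ^ (2 * k)" by (simp add: power_mult_distrib)
  also have "\<dots> \<le> (sqrt 2 * \<alpha> + 1)\<^sup>2 * (2 powr (- H)) ^ (2 * k)"
    using \<open>\<alpha> > 0\<close> by (intro mult_right_mono power_mono) auto
  finally show "(\<Sum>r<2 ^ k. (dyadic_incr h k r i)\<^sup>2) \<le> (sqrt 2 * \<alpha> + 1)\<^sup>2 * (2 powr (- H)) ^ (2 * k)" .
qed

theorem proposition4:
  fixes H c p \<gamma> \<alpha> :: real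
  assumes H: "1/4 < H" "H < 1/2"
    and c: "fbm_normalizing H c"
    and p: "1 < p" "p < 4" "p * H > 1"
    and \<gamma>: "\<gamma> > 0"
    and \<alpha>: "\<alpha> > 0"
  shows "(\<forall>j\<in>{1, 2, 3}.
            ((\<lambda>(m, m'). SUP h\<in>(fbm_rkhs_ball H c \<alpha> :: (real \<Rightarrow> real ^ 'd::finite) set).
                rough_dist \<gamma> j p (iterated_integral (dyadic_interp m h))
                                 (iterated_integral (dyadic_interp m' h)))
              \<longlongrightarrow> 0) (sequentially \<times>\<^sub>F sequentially))
       \<and> (\<forall>j\<in>{1, 2}.
            (SUP m\<in>{1..}. SUP h\<in>(fbm_rkhs_ball H c \<alpha> :: (real \<Rightarrow> real ^ 'd::finite) set).
                rough_size \<gamma> j p (iterated_integral (dyadic_interp m h))) < \<infinity>)"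
proof -
  let ?B = "fbm_rkhs_ball H c \<alpha> :: (real \<Rightarrow> real ^ 'd::finite) set"
  define \<beta> where "\<beta> = sqrt 2 * \<alpha> + 1"
  define \<theta> where "\<theta> = 2 powr (- H)"
  define C where "C = \<beta> ^ 3 * (4 + 1 / (1 - \<theta>)) / (1 - \<theta>\<^sup>2)"
  define \<rho> where "\<rho> = 2 powr (1 - p * H)"
  define D where "D j = sqrt (real (card {w :: 'd list. length w = j}))" for j
  have H0: "0 < H" using H by simp
  have scale: "rough_path_scale h \<beta> \<theta>" if "h \<in> ?B" for h :: "real \<Rightarrow> real ^ 'd"
    unfolding \<beta>_def \<theta>_def using fbm_rkhs_ball_scale[OF H0 H(2) c \<alpha> that] .
  \<comment> \<open>The constant depends on \<beta> and \<theta> alone, which makes the bounds below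
    uniform in \<open>h\<close>.\<close>
  have Ceq: "rough_path_scale.C \<beta> \<theta> = C" if "h \<in> ?B" for h :: "real \<Rightarrow> real ^ 'd"
    using rough_path_scale.C_def[OF scale[OF that]] rough_path_scale.K_def[OF scale[OF that]]
    by (simp add: C_def)
  have \<theta>: "0 < \<theta>" "\<theta> < 1"
    using powr_less_mono[of "- H" 0 "2::real"] H0 by (auto simp: \<theta>_def)
  have C: "0 \<le> C" using \<theta> \<alpha> power_le_one[of \<theta> 2] by (simp add: C_def \<beta>_def)
  have \<rho>: "0 < \<rho>" "\<rho> < 1"
    using powr_less_mono[of "1 - p * H" 0 "2::real"] p by (auto simp: \<rho>_def)
  have D0: "D j \<ge> 0" for j by (simp add: D_def)
  \<comment> \<open>Majorant of the term of level \<open>Suc k\<close> when coordinates are at most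
    \<open>2 * C * \<theta> ^ (j * Suc k)\<close>.\<close>
  define M where "M j k = (D j * (2 * C)) powr (p / real j) * (real (Suc k) powr \<gamma> * \<rho> ^ Suc k)" for j k
  have M1: "summable (M j)" for j
    unfolding M_def by (rule summable_mult[OF summable_powr_geometric[OF \<rho>]])
  have M2: "M j k \<ge> 0" for j k
    unfolding M_def by (intro mult_nonneg_nonneg zero_le_power powr_ge_zero less_imp_le[OF \<rho>(1)])
  note M = M1 M2
  have level: "real n powr \<gamma> * 2 ^ n * (D j * (2 * C * \<theta> ^ (j * n) * \<eta>)) powr (p / real j)
      = M j (n - 1) * \<eta> powr (p / real j)" if "j > 0" "n > 0" "\<eta> \<ge> 0" for j n \<eta>
    using level_term[of H p j "D j * (2 * C)" \<eta> n \<gamma>] that H0 p D0[of j] C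
    by (simp add: M_def \<theta>_def \<rho>_def mult.assoc)

  have size: "rough_size \<gamma> j p (iterated_integral (dyadic_interp m h)) \<le> ennreal ((\<Sum>k. M j k) powr (real j / p))"
    if j: "j \<in> {1, 2, 3}" and h: "h \<in> ?B" for j m and h :: "real \<Rightarrow> real ^ 'd"
    unfolding rough_size_def
  proof (rule rough_dist_le[where e = "\<lambda>n. 2 * C * \<theta> ^ (j * n) * 1"])
    fix n l :: nat and w :: "'d list" assume "l < 2 ^ n" "length w = j"
    then show "\<bar>iterated_integral (dyadic_interp m h) (real l / 2 ^ n) (real (Suc l) / 2 ^ n) w - 0\<bar> \<le> 2 * C * \<theta> ^ (j * n) * 1"
      using rough_path_scale.bound[OF scale[OF h], of w l n m] j Ceq[OF h]
      by (simp add: dyadic_integral_def)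
  next
    fix n :: nat assume "n > 0"
    then show "real n powr \<gamma> * 2 ^ n * (sqrt (real (card {w :: 'd list. length w = j})) * (2 * C * \<theta> ^ (j * n) * 1)) powr (p / real j) \<le> M j (n - 1)"
      using level[of j n 1] j by (auto simp: D_def[symmetric])
  qed (use p j M in auto)

  have limit: "((\<lambda>(m, m'). SUP h\<in>?B. rough_dist \<gamma> j p (iterated_integral (dyadic_interp m h))
                                 (iterated_integral (dyadic_interp m' h)))
              \<longlongrightarrow> 0) (sequentially \<times>\<^sub>F sequentially)" if j: "j \<in> {1, 2, 3}" for j
  proof -
    \<comment> \<open>With \<open>q = min m m'\<close>, levels \<open>n \<le> q\<close> gain from
      \<open>diff_bound\<close>. On finer levels the two paths are only bounded separately, and the
      triangle inequality gives the factor 2.\<close>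
    define \<eta> where "\<eta> q n = (if n \<le> q then \<theta> ^ (2 * (q - n)) else 2)" for q n :: nat
    have \<eta>: "0 \<le> \<eta> q n" "\<eta> q n \<le> 2" for q n
      using \<theta> power_le_one[of \<theta> "2 * (q - n)"] by (auto simp: \<eta>_def)
    define F where "F q k = M j k * \<eta> q (Suc k) powr (p / real j)" for q k
    have F0: "F q k \<ge> 0" for q k using M(2) by (simp add: F_def)
    have FM: "F q k \<le> M j k * 2 powr (p / real j)" for q k
      unfolding F_def using \<eta> M(2) p by (intro mult_left_mono powr_mono2) auto
    have sM: "summable (\<lambda>k. M j k * 2 powr (p / real j))" by (intro summable_mult2 M)
    have sF: "summable (F q)" for q
      using F0 FM by (intro summable_comparison_test'[OF sM]) auto
    have "(\<lambda>q. F q k) \<longlonglongrightarrow> 0" for k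
    proof -
      have "(\<lambda>d. \<theta> ^ (2 * d)) \<longlonglongrightarrow> 0"
        unfolding power_mult using \<theta> by (intro LIMSEQ_power_zero) (simp add: power_less_one_iff)
      \<comment> \<open>Shifting \<open>q\<close> by the fixed level places it in the first case of
        \<eta>.\<close>
      then have "(\<lambda>q. \<eta> (q + Suc k) (Suc k)) \<longlonglongrightarrow> 0" by (simp add: \<eta>_def)
      then have "(\<lambda>q. \<eta> q (Suc k)) \<longlonglongrightarrow> 0" by (rule LIMSEQ_offset)
      then have "(\<lambda>q. \<eta> q (Suc k) powr (p / real j)) \<longlonglongrightarrow> 0 powr (p / real j)"
        using \<eta> p j by (intro tendsto_powr') auto
      then have "(\<lambda>q. M j k * \<eta> q (Suc k) powr (p / real j)) \<longlonglongrightarrow> M j k * 0"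
        by (intro tendsto_mult_left) simp
      then show ?thesis by (simp add: F_def)
    qed
    then have "(\<lambda>q. \<Sum>k. F q k) \<longlonglongrightarrow> (\<Sum>k. 0)"
      using tannerys_theorem[where a = "\<lambda>k q. F q k" and b = "\<lambda>k. 0" and F = sequentially, OF _ _ sM] F0 FM
      by (auto intro!: always_eventually)
    then have "(\<lambda>q. (\<Sum>k. F q k) powr (real j / p)) \<longlonglongrightarrow> 0 powr (real j / p)"
      using p j suminf_nonneg[OF sF F0] by (intro tendsto_powr') auto
    then have "(\<lambda>q. ennreal ((\<Sum>k. F q k) powr (real j / p))) \<longlonglongrightarrow> 0"
      using tendsto_ennrealI by fastforce
    \<comment> \<open>The bound depends on the pair only through the minimum, so the double limit
      reduces to a limit of a sequence.\<close>
    then have lim: "((\<lambda>x. ennreal ((\<Sum>k. F (case x of (m, m') \<Rightarrow> min m m') k) powr (real j / p))) \<longlongrightarrow> 0)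
        (sequentially \<times>\<^sub>F sequentially)"
      by (rule filterlim_compose[OF _ filterlim_min_sequentially])
    have bound: "rough_dist \<gamma> j p (iterated_integral (dyadic_interp m h)) (iterated_integral (dyadic_interp m' h))
        \<le> ennreal ((\<Sum>k. F (min m m') k) powr (real j / p))"
      if h: "h \<in> ?B" for m m' and h :: "real \<Rightarrow> real ^ 'd"
    proof (rule rough_dist_le[where e = "\<lambda>n. 2 * C * \<theta> ^ (j * n) * \<eta> (min m m') n"])
      fix n l :: nat and w :: "'d list" assume l: "l < 2 ^ n" and w: "length w = j"
      let ?x = "\<lambda>m. dyadic_integral m h n l w"
      have "\<bar>?x m - ?x m'\<bar> \<le> 2 * C * \<theta> ^ (j * n) * \<eta> (min m m') n"
      proof (cases "n \<le> min m m'")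
        case True
        \<comment> \<open>\<open>diff_bound\<close> expects the coarser interpolation first; the
          absolute value is symmetric in the two.\<close>
        have "\<bar>?x (max m m') - ?x (min m m')\<bar> \<le> C * \<theta> ^ (2 * (min m m' - n)) * \<theta> ^ (j * n)"
          using rough_path_scale.diff_bound[OF scale[OF h], of w n "min m m'" l "max m m'"] True l w j Ceq[OF h] by auto
        also have "\<dots> \<le> 2 * (C * \<theta> ^ (2 * (min m m' - n)) * \<theta> ^ (j * n))"
          using C \<theta> by simp
        also have "\<dots> = 2 * C * \<theta> ^ (j * n) * \<eta> (min m m') n" using True by (simp add: \<eta>_def)
        finally show ?thesis by (auto simp: max_def min_def abs_minus_commute split: if_splits)
      next
        case False
        have "\<bar>?x m\<bar> \<le> 2 * C * \<theta> ^ (j * n)" "\<bar>?x m'\<bar> \<le> 2 * C * \<theta> ^ (j * n)"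
          using rough_path_scale.bound[OF scale[OF h], of w l n] l w j Ceq[OF h] by auto
        moreover have "\<eta> (min m m') n = 2" using False by (simp only: \<eta>_def if_False)
        ultimately show ?thesis using abs_triangle_ineq4[of "?x m" "?x m'"] by simp
      qed
      then show "\<bar>iterated_integral (dyadic_interp m h) (real l / 2 ^ n) (real (Suc l) / 2 ^ n) w
          - iterated_integral (dyadic_interp m' h) (real l / 2 ^ n) (real (Suc l) / 2 ^ n) w\<bar>
          \<le> 2 * C * \<theta> ^ (j * n) * \<eta> (min m m') n"
        by (simp add: dyadic_integral_def)
    next
      fix n :: nat assume "n > 0"
      then show "real n powr \<gamma> * 2 ^ n * (sqrt (real (card {w :: 'd list. length w = j}))
          * (2 * C * \<theta> ^ (j * n) * \<eta> (min m m') n)) powr (p / real j) \<le> F (min m m') (n - 1)"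
        using level[of j n "\<eta> (min m m') n"] j \<eta> by (auto simp: D_def[symmetric] F_def)
    qed (use p j sF in auto)
    show ?thesis
      by (rule tendsto_sandwich[OF _ _ tendsto_const lim])
         (auto intro!: always_eventually SUP_least bound)
  qed

  have "(SUP m\<in>{1..}. SUP h\<in>?B. rough_size \<gamma> j p (iterated_integral (dyadic_interp m h))) < \<infinity>"
    if "j \<in> {1, 2}" for j
  proof -
    have "(SUP m\<in>{1..}. SUP h\<in>?B. rough_size \<gamma> j p (iterated_integral (dyadic_interp m h)))
        \<le> ennreal ((\<Sum>k. M j k) powr (real j / p))"
      using that by (intro SUP_least size) auto
    also have "\<dots> < \<infinity>" by simp
    finally show ?thesis .
  qed
  with limit show ?thesis by blast
qed

end
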